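(* Let $\Gamma$ be a finite additive Abelian group of order $n$, let $B\subseteq\Gamma\setminus\{0\}$ satisfy $B=-B$, and suppose that $H=\mathrm{Cayley}(\Gamma,B)$ is a connected graph with adjacency matrix $A$, whose $(i,j)$ entry is equal to $\delta_B(i-j)$. Let $A$ have minimum polynomial $p_A(t)$ of degree $\ell$ equal to the number of distinct eigenvalues $\widehat{\delta_B}(i)$ of $A$, and set $$\frac{p_A(t)}{t-|B|}=q(t)=q_0+q_1t+\cdots+q_{\ell-1}t^{\ell-1}.$$ Define $\widehat{H}$ to be the edge-weighted graph on vertex set $\Gamma$ with adjacency matrix having $(i,j)$ entry $\widehat{\delta_B}(i-j)$. Then: (i) A contractor for the number of $B$-flows is given by $$Z=\frac{n}{q(|B|)}\sum_{0\le k\le \ell-1}q_kP_1^{k},$$ where $P_1^{k}$ is the 2-labelled graph consisting of two vertices, one labelled $1$ and the other labelled $2$, joined by $k$ parallel edges (in particular, $P_1^0=\overline{K}_2$). (ii) A contractor for $n^{c(G)}$ times the number of $B$-tensions of $G$, where $c(G)$ is the number of connected components of $G$, is given by $$Z=\frac{1}{q_0}\left[\frac{q(|B|)}{n}\overline{K}_2-\sum_{1\le k\le \ell-1}q_kP_k\right].$$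
   Context: **Cayley graph.** $\delta_B$ is the indicator function of $B\subseteq\Gamma$. $\mathrm{Cayley}(\Gamma,B)$ is the graph on vertex set $\Gamma$ with $i,j$ adjacent if and only if $j-i\in B$. **Fourier transform.** Fix a commutative ring structure with unity on $\Gamma$ and a generating character $\chi$, i.e. a homomorphism $\chi:\Gamma\to\mathbb{C}^\times$ such that, writing $\chi_x(y)=\chi(xy)$, the map $x\mapsto\chi_x$ is an isomorphism from $\Gamma$ to its character group (such a choice always exists). For $\alpha:\Gamma\to\mathbb{C}$ its Fourier transform is $\widehat{\alpha}(y)=\sum_{x\in\Gamma}\alpha(x)\chi_y(-x)$. **Flows and tensions.** Let $G=(V,E)$ be a finite graph (parallel edges and loops allowed) with an arbitrary fixed orientation of its edges. A $\Gamma$-flow is a function $g:E\to\Gamma$ such that for every vertex $v$ the sum of $g(e)$ over non-loop edges $e$ with head $v$ equals the sum of $g(e)$ over non-loop edges $e$ with tail $v$. A $\Gamma$-tension is a function $g:E\to\Gamma$ for which there is $f:V\to\Gamma$ with $g(e)=f(v)-f(u)$ for each edge $e$ with tail $u$ and head $v$. A $B$-flow (resp. $B$-tension) is a $\Gamma$-flow (resp. $\Gamma$-tension) all of whose values lie in $B$. As $B=-B$, the numbers of these do not depend on the orientation. **2-labelled graphs.** A 2-labelled graph is a finite graph $X$, without loops but possibly with parallel edges, together with a map $\lambda:\{1,2\}\to V(X)$ (the vertex $\lambda(i)$ is said to carry label $i$; a vertex may carry both labels). A 2-labelled quantum graph is a finite formal linear combination of 2-labelled graphs with real coefficients. The product $XY$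 of 2-labelled graphs is obtained by taking the disjoint union of $X$ and $Y$ and identifying vertices carrying the same label (keeping all edges, with multiplicity); it is extended bilinearly to quantum graphs. $K_1$ denotes a single vertex carrying both labels, so $XK_1$ is $X$ with its vertices labelled 1 and 2 identified. $\overline{K}_2$ denotes two isolated vertices, one labelled 1 and the other labelled 2. $P_k$ ($k\ge1$) denotes the path with $k$ edges, one endpoint labelled 1 and the other labelled 2. **Contractor.** A graph parameter $h$ (an isomorphism-invariant function on graphs) is evaluated on a 2-labelled graph by ignoring labels and is extended linearly to 2-labelled quantum graphs. A 2-labelled quantum graph $Z$ is a contractor for $h$ if $h(XZ)=h(XK_1)$ for every 2-labelled graph $X$ whose vertices labelled 1 and 2 are distinct and non-adjacent (equivalently, for all linear combinations of such $X$).
   Formalization: Part (ii) is stated only when q_0 is nonzero, since the formula for Z contains 1/q_0; for example, for Γ = Z_4 and B = {1,3} one has q(t) = t(t+2), so q_0 = 0 and Z is undefined. *)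

theory Defs
  imports
    "HOL-Analysis.Analysis"
    "HOL-Computational_Algebra.Polynomial"
    "HOL-Library.Poly_Mapping"
    "HOL-Library.FuncSet"
    "HOL-Library.Indicator_Function"
    "Graph_Theory.Graph_Theory"
begin

text \<open>
  The group is the additive group of a type of sort \<open>{ab_group_add, finite}\<close>.  A unital
  commutative ring structure on it is given by explicit operations instead of the class
  \<open>comm_ring_1\<close>, because that class would exclude the trivial group.
\<close>

definition ring_structure :: "('a::ab_group_add \<Rightarrow> 'a \<Rightarrow> 'a) \<Rightarrow> 'a \<Rightarrow> bool" where
  "ring_structure mul u \<longleftrightarrow>
     comm_monoid mul u \<and> (\<forall>x y z. mul x (y + z) = mul x y + mul x z)"

definition characters :: "('a::ab_group_add \<Rightarrow> complex) set" where
  "characters = {\<psi>. (\<forall>x. \<psi> x \<noteq> 0) \<and> (\<forall>x y. \<psi> (x + y) = \<psi> x * \<psi> y)}"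

definition generating_character ::
    "('a::ab_group_add \<Rightarrow> 'a \<Rightarrow> 'a) \<Rightarrow> ('a \<Rightarrow> complex) \<Rightarrow> bool" where
  "generating_character mul \<xi> \<longleftrightarrow>
     \<xi> \<in> characters \<and>
     bij_betw (\<lambda>x y. \<xi> (mul x y)) UNIV characters \<and>
     (\<forall>x x' y. \<xi> (mul (x + x') y) = \<xi> (mul x y) * \<xi> (mul x' y))"

definition fourier ::
    "('a::{ab_group_add,finite} \<Rightarrow> 'a \<Rightarrow> 'a) \<Rightarrow> ('a \<Rightarrow> complex) \<Rightarrow> ('a \<Rightarrow> complex) \<Rightarrow> 'a \<Rightarrow> complex"
  where "fourier mul \<xi> \<alpha> y = (\<Sum>x\<in>UNIV. \<alpha> x * \<xi> (mul y (- x)))"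

definition cayley :: "'a::ab_group_add set \<Rightarrow> 'a pair_pre_digraph" where
  "cayley B = \<lparr>pverts = UNIV, parcs = {(i, j). j - i \<in> B}\<rparr>"

definition cayley_matrix :: "'a::{ab_group_add,finite} set \<Rightarrow> (('b::zero_neq_one, 'a) vec, 'a) vec" where
  "cayley_matrix B = (\<chi> i j. indicator B (i - j))"

text \<open>The edge-weighted graph dual to \<open>cayley B\<close>, given by its adjacency matrix.\<close>

definition dual_matrix ::
    "('a::{ab_group_add,finite} \<Rightarrow> 'a \<Rightarrow> 'a) \<Rightarrow> ('a \<Rightarrow> complex) \<Rightarrow> 'a set \<Rightarrow> ((complex, 'a) vec, 'a) vec" where
  "dual_matrix mul \<xi> B = (\<chi> i j. fourier mul \<xi> (indicator B) (i - j))"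

definition eigenvalue_of :: "'b::field^'n^'n \<Rightarrow> 'b \<Rightarrow> bool" where
  "eigenvalue_of A c \<longleftrightarrow> (\<exists>v. v \<noteq> 0 \<and> A *v v = c *s v)"

text \<open>The class operation \<open>^\<close> on \<open>real^'n^'n\<close> is the entrywise power, hence the iteration of \<open>**\<close>.\<close>

definition matrix_poly :: "real poly \<Rightarrow> real^'n^'n \<Rightarrow> real^'n^'n" where
  "matrix_poly p A = (\<Sum>k\<le>degree p. coeff p k *\<^sub>R (((**) A ^^ k) (mat 1)))"

definition minimum_polynomial :: "real^'n^'n \<Rightarrow> real poly \<Rightarrow> bool" where
  "minimum_polynomial A p \<longleftrightarrow>
     lead_coeff p = 1 \<and> matrix_poly p A = 0 \<and>
     (\<forall>r. r \<noteq> 0 \<and> matrix_poly r A = 0 \<longrightarrow> degree p \<le> degree r)"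

text \<open>
  A finite graph (loops and parallel edges allowed) with a chosen orientation is a
  \<open>fin_digraph\<close>.  Flows and tensions are extensional functions on the arcs, so that they
  can be counted.
\<close>

definition flows :: "('v,'e) pre_digraph \<Rightarrow> ('e \<Rightarrow> 'a::ab_group_add) set" where
  "flows G = {g \<in> arcs G \<rightarrow>\<^sub>E UNIV. \<forall>v\<in>verts G.
     (\<Sum>e\<in>{e \<in> arcs G. head G e = v \<and> tail G e \<noteq> v}. g e) =
     (\<Sum>e\<in>{e \<in> arcs G. tail G e = v \<and> head G e \<noteq> v}. g e)}"

definition tensions :: "('v,'e) pre_digraph \<Rightarrow> ('e \<Rightarrow> 'a::ab_group_add) set" where
  "tensions G = {g \<in> arcs G \<rightarrow>\<^sub>E UNIV.
     \<exists>f::'v \<Rightarrow> 'a. \<forall>e\<in>arcs G. g e = f (head G e) - f (tail G e)}"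

definition B_flows :: "'a::ab_group_add set \<Rightarrow> ('v,'e) pre_digraph \<Rightarrow> ('e \<Rightarrow> 'a) set" where
  "B_flows B G = {g \<in> flows G. g ` arcs G \<subseteq> B}"

definition B_tensions :: "'a::ab_group_add set \<Rightarrow> ('v,'e) pre_digraph \<Rightarrow> ('e \<Rightarrow> 'a) set" where
  "B_tensions B G = {g \<in> tensions G. g ` arcs G \<subseteq> B}"

definition num_components :: "('v,'e) pre_digraph \<Rightarrow> nat" where
  "num_components G = card (pre_digraph.sccs_verts (with_proj (mk_symmetric G)))"

datatype ('v,'e) lgraph =
  LGraph (unlabel: "('v,'e) pre_digraph") (lab1: 'v) (lab2: 'v)

definition two_labelled :: "('v,'e) lgraph \<Rightarrow> bool" where
  "two_labelled X \<longleftrightarrow>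
     fin_digraph (unlabel X) \<and> loopfree_digraph (unlabel X) \<and>
     lab1 X \<in> verts (unlabel X) \<and> lab2 X \<in> verts (unlabel X)"

text \<open>
  The vertices of the product are the classes of the disjoint union under the equivalence
  relation generated by the identification of equally labelled vertices.
\<close>

definition glue_class ::
    "('v,'e) lgraph \<Rightarrow> ('w,'f) lgraph \<Rightarrow> 'v + 'w \<Rightarrow> ('v + 'w) set" where
  "glue_class X Y v =
     (let R = {(Inl (lab1 X), Inr (lab1 Y)), (Inl (lab2 X), Inr (lab2 Y))}
      in (R \<union> R\<inverse>)\<^sup>* `` {v})"

definition lgraph_prod ::
    "('v,'e) lgraph \<Rightarrow> ('w,'f) lgraph \<Rightarrow> (('v + 'w) set, 'e + 'f) lgraph" where
  "lgraph_prod X Y = LGraph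
     \<lparr>verts = glue_class X Y ` (verts (unlabel X) <+> verts (unlabel Y)),
      arcs = arcs (unlabel X) <+> arcs (unlabel Y),
      tail = glue_class X Y \<circ> map_sum (tail (unlabel X)) (tail (unlabel Y)),
      head = glue_class X Y \<circ> map_sum (head (unlabel X)) (head (unlabel Y))\<rparr>
     (glue_class X Y (Inl (lab1 X)))
     (glue_class X Y (Inl (lab2 X)))"

type_synonym ('v,'e) qgraph = "('v,'e) lgraph \<Rightarrow>\<^sub>0 real"

definition qscale :: "real \<Rightarrow> ('v,'e) qgraph \<Rightarrow> ('v,'e) qgraph" where
  "qscale c Z = Poly_Mapping.map ((*) c) Z"

definition qprod ::
    "('v,'e) qgraph \<Rightarrow> ('w,'f) qgraph \<Rightarrow> (('v + 'w) set, 'e + 'f) qgraph" where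
  "qprod W Z = (\<Sum>X\<in>Poly_Mapping.keys W. \<Sum>Y\<in>Poly_Mapping.keys Z.
     Poly_Mapping.single (lgraph_prod X Y) (Poly_Mapping.lookup W X * Poly_Mapping.lookup Z Y))"

abbreviation qof :: "('v,'e) lgraph \<Rightarrow> ('v,'e) qgraph" where
  "qof X \<equiv> Poly_Mapping.single X 1"

definition qeval :: "(('v,'e) pre_digraph \<Rightarrow> real) \<Rightarrow> ('v,'e) qgraph \<Rightarrow> real" where
  "qeval h Z = (\<Sum>X\<in>Poly_Mapping.keys Z. Poly_Mapping.lookup Z X * h (unlabel X))"

definition K1 :: "(nat,nat) lgraph" where
  "K1 = LGraph \<lparr>verts = {0}, arcs = {}, tail = (\<lambda>_. 0), head = (\<lambda>_. 0)\<rparr> 0 0"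

definition K2_bar :: "(nat,nat) lgraph" where
  "K2_bar = LGraph \<lparr>verts = {0, 1}, arcs = {}, tail = (\<lambda>_. 0), head = (\<lambda>_. 1)\<rparr> 0 1"

definition path_graph :: "nat \<Rightarrow> (nat,nat) lgraph" where
  "path_graph k = LGraph \<lparr>verts = {0..k}, arcs = {0..<k}, tail = (\<lambda>e. e), head = Suc\<rparr> 0 k"

definition parallel_graph :: "nat \<Rightarrow> (nat,nat) lgraph" where
  "parallel_graph k =
     LGraph \<lparr>verts = {0, 1}, arcs = {0..<k}, tail = (\<lambda>_. 0), head = (\<lambda>_. 1)\<rparr> 0 1"

lemma parallel_graph_0: "parallel_graph 0 = K2_bar"
  by (simp add: parallel_graph_def K2_bar_def)

text \<open>
  Terms of \<open>Z\<close> live on natural numbers.  The type of the parameter \<open>h\<close> determines the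
  vertex and edge types of the test graphs \<open>X\<close>, which stay arbitrary in what follows.
\<close>

definition contractor ::
    "(((('v + nat) set, 'e + nat) pre_digraph) \<Rightarrow> real) \<Rightarrow> (nat,nat) qgraph \<Rightarrow> bool" where
  "contractor h Z \<longleftrightarrow>
     (\<forall>Y\<in>Poly_Mapping.keys Z. two_labelled Y) \<and>
     (\<forall>X::('v,'e) lgraph.
        two_labelled X \<and> lab1 X \<noteq> lab2 X \<and>
        (lab1 X, lab2 X) \<notin> arcs_ends (unlabel X) \<and> (lab2 X, lab1 X) \<notin> arcs_ends (unlabel X) \<longrightarrow>
        qeval h (qprod (qof X) Z) = qeval h (qprod (qof X) (qof K1)))"

end

theory Submission
  imports Defs
begin

text \<open>
  Both counts are homomorphism numbers into weighted graphs on the group.  A \<open>B\<close>-tension is the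
  difference of a potential, which is determined up to a constant on each component; so
  \<open>n ^ c(G)\<close> times the number of \<open>B\<close>-tensions counts the homomorphisms from \<open>G\<close> to the Cayley graph
  (\<open>hom_sum_indicator\<close>).  Dually, expanding the eigenvalues of the Cayley graph as character
  sums shows that \<open>n\<close> to the number of vertices, times the number of \<open>B\<close>-flows, is the homomorphism
  number into the graph whose arc from \<open>i\<close> to \<open>j\<close> has as weight the eigenvalue at \<open>j - i\<close>
  (\<open>hom_sum_spectrum\<close>).

  A homomorphism number of a product is obtained by fixing the images \<open>a\<close> and \<open>b\<close> of the two labelled
  vertices, multiplying the pinned numbers of the factors, and summing over \<open>a\<close> and \<open>b\<close>
  (\<open>hom_sum_prod\<close>).  The pinned number of \<open>K1\<close> is the identity matrix.  It therefore suffices, up to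
  the normalisation by \<open>n\<close>, that the pinned numbers of \<open>Z\<close> also form the identity matrix.

  For \<open>k\<close> parallel arcs and the dual weight, the pinned number is the \<open>k\<close>-th power of the eigenvalue
  at \<open>b - a\<close>; for the path with \<open>k\<close> arcs and the Cayley graph, it is an entry of \<open>A ^ k\<close>.  So the two
  claims are two facts about the polynomial \<open>q\<close>.  It vanishes at every eigenvalue but \<open>card B\<close>, which
  by connectedness is the eigenvalue at \<open>0\<close> only (\<open>quotient_polynomial\<close>); this gives the contractor
  for flows.  By Fourier inversion \<open>q(A)\<close> is then a constant matrix
  (\<open>poly_conv_quotient\<close>), and solving for the constant term of \<open>q(A)\<close> gives the contractor for tensions.
\<close>

section \<open>Fourier analysis on a finite abelian group\<close>

text \<open>
  The model is \<open>e x y = \<xi> (mul x y)\<close> for a generating character \<open>\<xi>\<close> of a commutative ring: each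
  \<open>e x\<close> is a character, and nondegeneracy says that only \<open>e 0\<close> is trivial.  This yields the
  orthogonality relations and hence Fourier inversion.
\<close>

locale nondegenerate_bicharacter =
  fixes e :: "'a::{ab_group_add,finite} \<Rightarrow> 'a \<Rightarrow> complex"
  assumes nonzero: "e x y \<noteq> 0"
    and add_right: "e x (y + z) = e x y * e x z"
    and sym: "e x y = e y x"
    and nondegenerate: "(\<And>y. e x y = 1) \<Longrightarrow> x = 0"
begin

lemma zero_right [simp]: "e x 0 = 1"
  using add_right[of x 0 0] nonzero[of x 0] by simp

lemma zero_left [simp]: "e 0 x = 1"
  using sym[of 0 x] by simp

lemma add_left: "e (x + y) z = e x z * e y z"
  using add_right[of z x y] sym by metis

lemma minus_right: "e x (- y) = inverse (e x y)"
  using add_right[of x y "- y"] nonzero[of x y] by (simp add: field_simps)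

lemma minus_left: "e (- x) y = e x (- y)"
  using minus_right[of x y] minus_right[of y x] sym by metis

lemma diff_left: "e (x - y) z = e x z * e y (- z)"
  using add_left[of x "- y" z] by (simp add: minus_left)

lemma diff_right: "e x (y - z) = e x y * e x (- z)"
  using add_right[of x y "- z"] by simp

lemma sum_right: "e x (sum f S) = (\<Prod>i\<in>S. e x (f i))"
  by (induction S rule: infinite_finite_induct) (simp_all add: add_right)

text \<open>Translation by \<open>y\<close> permutes the group and multiplies \<open>\<Prod>\<^sub>z e x z\<close> by \<open>e x y ^ n\<close>, so
  \<open>e x y\<close> is a root of unity.\<close>

lemma norm_eq_1 [simp]: "norm (e x y) = 1"
proof -
  have "(\<Prod>z\<in>UNIV. e x z) = (\<Prod>z\<in>UNIV. e x (y + z))"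
    by (rule prod.reindex_bij_witness[of _ "\<lambda>z. y + z" "\<lambda>z. z - y"]) auto
  also have "\<dots> = e x y ^ CARD('a) * (\<Prod>z\<in>UNIV. e x z)"
    by (simp add: add_right prod.distrib)
  finally have "e x y ^ CARD('a) = 1"
    by (simp add: nonzero)
  then have "norm (e x y) ^ CARD('a) = 1 ^ CARD('a)"
    by (metis norm_one norm_power power_one)
  then show ?thesis
    by (rule power_eq_imp_eq_base) auto
qed

lemma minus_right_cnj: "e x (- y) = cnj (e x y)"
proof -
  have "e x y * cnj (e x y) = 1"
    by (simp flip: complex_norm_square)
  then show ?thesis
    using nonzero[of x y] by (simp add: minus_right field_simps)
qed

text \<open>For \<open>x \<noteq> 0\<close>, translating the summation variable by some \<open>z\<close> with \<open>e x z \<noteq> 1\<close> multiplies the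
  sum by \<open>e x z\<close> and leaves it unchanged.\<close>

lemma sum_character: "(\<Sum>y\<in>UNIV. e x y) = (if x = 0 then of_nat CARD('a) else 0)"
proof (cases "x = 0")
  case False
  then obtain z where z: "e x z \<noteq> 1"
    using nondegenerate by blast
  have "(\<Sum>y\<in>UNIV. e x y) = (\<Sum>y\<in>UNIV. e x (z + y))"
    by (rule sum.reindex_bij_witness[of _ "\<lambda>y. z + y" "\<lambda>y. y - z"]) auto
  also have "\<dots> = e x z * (\<Sum>y\<in>UNIV. e x y)"
    by (simp add: add_right sum_distrib_left)
  finally show ?thesis
    using z False by simp
qed simp

definition dft :: "('a \<Rightarrow> complex) \<Rightarrow> 'a \<Rightarrow> complex" where
  "dft f y = (\<Sum>x\<in>UNIV. f x * e y (- x))"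

theorem dft_inversion: "(\<Sum>y\<in>UNIV. dft f y * e y z) = of_nat CARD('a) * f z"
proof -
  have "(\<Sum>y\<in>UNIV. dft f y * e y z) = (\<Sum>y\<in>UNIV. \<Sum>x\<in>UNIV. f x * e (z - x) y)"
    unfolding dft_def sum_distrib_right
    by (intro sum.cong refl) (simp add: sym[of "z - _"] diff_right mult_ac)
  also have "\<dots> = (\<Sum>x\<in>UNIV. f x * (\<Sum>y\<in>UNIV. e (z - x) y))"
    by (subst sum.swap) (simp add: sum_distrib_left)
  also have "\<dots> = (\<Sum>x\<in>UNIV. if x = z then f x * of_nat CARD('a) else 0)"
    by (intro sum.cong) (auto simp: sum_character)
  finally show ?thesis by simp
qed

corollary dft_eq_0_iff: "(\<forall>y. dft f y = 0) \<longleftrightarrow> (\<forall>x. f x = 0)"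
proof
  assume "\<forall>y. dft f y = 0"
  then have "of_nat CARD('a) * f x = 0" for x
    using dft_inversion[of f x] by simp
  then show "\<forall>x. f x = 0" by simp
qed (simp add: dft_def)

lemma dft_convolution:
  "dft (\<lambda>x. \<Sum>c\<in>UNIV. f c * g (x - c)) y = dft f y * dft g y"
proof -
  have "dft (\<lambda>x. \<Sum>c\<in>UNIV. f c * g (x - c)) y
      = (\<Sum>c\<in>UNIV. \<Sum>x\<in>UNIV. f c * g (x - c) * e y (- x))"
    unfolding dft_def sum_distrib_right by (rule sum.swap)
  also have "\<dots> = (\<Sum>c\<in>UNIV. \<Sum>x\<in>UNIV. f c * g x * e y (- (x + c)))"
  proof (rule sum.cong[OF refl])
    fix c
    show "(\<Sum>x\<in>UNIV. f c * g (x - c) * e y (- x)) = (\<Sum>x\<in>UNIV. f c * g x * e y (- (x + c)))"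
      by (rule sum.reindex_bij_witness[of _ "\<lambda>x. x + c" "\<lambda>x. x - c"]) auto
  qed
  also have "\<dots> = (\<Sum>c\<in>UNIV. \<Sum>x\<in>UNIV. (f c * e y (- c)) * (g x * e y (- x)))"
    by (simp add: add_right diff_right mult_ac)
  also have "\<dots> = dft f y * dft g y"
    by (simp add: dft_def sum_product)
  finally show ?thesis .
qed

end

section \<open>Spectrum and minimum polynomial of a Cayley graph\<close>

text \<open>Evaluated at \<open>j - i\<close>, this is the \<open>(i, j)\<close> entry of the \<open>k\<close>-th power of the matrix with entries
  \<open>w (j - i)\<close>; for \<open>w = indicator B\<close> it counts the walks of length \<open>k\<close> in the Cayley graph.\<close>

fun conv_power :: "('a::{ab_group_add,finite} \<Rightarrow> 'b::comm_semiring_1) \<Rightarrow> nat \<Rightarrow> 'a \<Rightarrow> 'b" where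
  "conv_power w 0 d = (if d = 0 then 1 else 0)"
| "conv_power w (Suc k) d = (\<Sum>c\<in>UNIV. w c * conv_power w k (d - c))"

lemma of_real_conv_power:
  "complex_of_real (conv_power w k d) = conv_power (\<lambda>x. of_real (w x)) k d"
  by (induction k arbitrary: d) simp_all

lemma (in nondegenerate_bicharacter) dft_conv_power: "dft (conv_power w k) y = dft w y ^ k"
proof (induction k)
  case 0
  have "dft (conv_power w 0) y = (\<Sum>x\<in>UNIV. if x = 0 then e y (- x) else 0)"
    unfolding dft_def by (intro sum.cong) auto
  also have "\<dots> = 1" by simp
  finally show ?case by (simp del: conv_power.simps)
next
  case (Suc k)
  have "conv_power w (Suc k) = (\<lambda>x. \<Sum>c\<in>UNIV. w c * conv_power w k (x - c))"
    by (simp add: fun_eq_iff)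
  then show ?case
    using dft_convolution[of w "conv_power w k" y] Suc by simp
qed

text \<open>All polynomials in the adjacency matrix are again matrices whose entries depend on \<open>i - j\<close> only,
  so that they can be handled as functions on the group.\<close>

definition poly_conv :: "real poly \<Rightarrow> 'a::{ab_group_add,finite} set \<Rightarrow> 'a \<Rightarrow> real" where
  "poly_conv r B d = (\<Sum>k\<le>degree r. coeff r k * conv_power (indicator B) k d)"

lemma cayley_matrix_power:
  "((((**) (cayley_matrix B)) ^^ k) (mat 1)) $ i $ j = (conv_power (indicator B) k (i - j) :: real)"
proof (induction k arbitrary: i)
  case 0
  then show ?case by (simp add: mat_def)
next
  case (Suc k)
  have "((((**) (cayley_matrix B)) ^^ Suc k) (mat 1)) $ i $ j
      = (\<Sum>c\<in>UNIV. indicator B (i - c) * (conv_power (indicator B) k (c - j) :: real))"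
    by (simp add: matrix_matrix_mult_def cayley_matrix_def Suc[unfolded cayley_matrix_def])
  also have "\<dots> = (\<Sum>c\<in>UNIV. indicator B c * conv_power (indicator B) k (i - j - c))"
    by (rule sum.reindex_bij_witness[of _ "\<lambda>c. i - c" "\<lambda>c. i - c"]) (auto simp: algebra_simps)
  finally show ?case by simp
qed

lemma matrix_poly_cayley: "matrix_poly r (cayley_matrix B) $ i $ j = poly_conv r B (i - j)"
  by (simp add: matrix_poly_def poly_conv_def cayley_matrix_power)

lemma matrix_poly_cayley_eq_0_iff:
  "matrix_poly r (cayley_matrix B) = 0 \<longleftrightarrow> (\<forall>d. poly_conv r B d = 0)"
proof -
  have "(\<forall>i j. poly_conv r B (i - j) = 0) \<longleftrightarrow> (\<forall>d. poly_conv r B d = 0)"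
    by (metis diff_zero)
  then show ?thesis
    by (simp add: vec_eq_iff matrix_poly_cayley)
qed

context nondegenerate_bicharacter
begin

text \<open>The eigenvalues of the Cayley graph as real numbers; they are real because \<open>B = - B\<close>.\<close>

definition spectrum :: "'a set \<Rightarrow> 'a \<Rightarrow> real" where
  "spectrum B y = (\<Sum>b\<in>B. Re (e y b))"

lemma dft_indicator_sum: "dft (indicator B) y = (\<Sum>b\<in>B. e y (- b))"
proof -
  have "dft (indicator B) y = (\<Sum>b\<in>UNIV. if b \<in> B then e y (- b) else 0)"
    unfolding dft_def by (intro sum.cong) (auto simp: indicator_def)
  then show ?thesis by (simp add: sum.If_cases)
qed

lemma dft_indicator:
  assumes "B = uminus ` B"
  shows "dft (indicator B) y = of_real (spectrum B y)"
proof -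
  have d: "dft (indicator B) y = (\<Sum>b\<in>B. cnj (e y b))"
    by (simp add: dft_indicator_sum minus_right_cnj)
  have "(\<Sum>b\<in>B. e y (- b)) = (\<Sum>b\<in>B. e y b)"
    using assms by (subst (2) assms, subst sum.reindex) (auto simp: inj_on_def)
  then have "cnj (dft (indicator B) y) = dft (indicator B) y"
    unfolding d by (simp add: minus_right_cnj)
  then have "dft (indicator B) y = of_real (Re (dft (indicator B) y))"
    by (simp add: complex_eq_iff)
  then show ?thesis
    by (simp add: d spectrum_def)
qed

lemma dft_poly_conv:
  assumes "B = uminus ` B"
  shows "dft (\<lambda>d. of_real (poly_conv r B d)) y = of_real (poly r (spectrum B y))"
proof -
  have ind: "(\<lambda>x. complex_of_real (indicator B x)) = indicator B"
    by (auto simp: indicator_def)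
  have "dft (\<lambda>d. of_real (poly_conv r B d)) y
      = (\<Sum>x\<in>UNIV. \<Sum>k\<le>degree r. of_real (coeff r k) * conv_power (indicator B) k x * e y (- x))"
    by (simp add: dft_def poly_conv_def of_real_conv_power ind sum_distrib_right)
  also have "\<dots> = (\<Sum>k\<le>degree r. of_real (coeff r k) * dft (conv_power (indicator B) k) y)"
    by (subst sum.swap) (simp add: dft_def sum_distrib_left mult.assoc)
  finally show ?thesis
    by (simp add: dft_conv_power dft_indicator[OF assms] poly_altdef)
qed

text \<open>The transform turns \<open>r(A)\<close> into the values of \<open>r\<close> at the eigenvalues, and it is injective.\<close>

lemma matrix_poly_eq_0_iff_spectrum:
  assumes "B = uminus ` B"
  shows "matrix_poly r (cayley_matrix B) = 0 \<longleftrightarrow> (\<forall>y. poly r (spectrum B y) = 0)"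
  using dft_eq_0_iff[of "\<lambda>d. of_real (poly_conv r B d)"]
  by (simp add: matrix_poly_cayley_eq_0_iff dft_poly_conv[OF assms])

text \<open>The product of the linear factors of the distinct eigenvalues annihilates the matrix, and every
  annihilating polynomial has all of them as roots.\<close>

lemma degree_minimum_polynomial:
  assumes B: "B = uminus ` B" and p: "minimum_polynomial (cayley_matrix B) p"
  shows "degree p = card (range (spectrum B))"
proof (rule antisym)
  define r where "r = (\<Prod>c\<in>range (spectrum B). [:- c, 1:])"
  have "matrix_poly r (cayley_matrix B) = 0"
    by (auto simp: matrix_poly_eq_0_iff_spectrum[OF B] r_def poly_prod intro!: prod_zero)
  moreover have "r \<noteq> 0"
    by (auto simp: r_def)
  ultimately have "degree p \<le> degree r"
    using p by (auto simp: minimum_polynomial_def)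
  also have "degree r = card (range (spectrum B))"
    by (simp add: r_def degree_prod_sum_eq)
  finally show "degree p \<le> card (range (spectrum B))" .
next
  have "p \<noteq> 0"
    using p by (auto simp: minimum_polynomial_def)
  moreover have "range (spectrum B) \<subseteq> {c. poly p c = 0}"
    using p matrix_poly_eq_0_iff_spectrum[OF B] by (auto simp: minimum_polynomial_def)
  ultimately show "card (range (spectrum B)) \<le> degree p"
    using card_mono[OF poly_roots_finite] card_poly_roots_bound[of p] le_trans by blast
qed

text \<open>Since \<open>\<bar>e y b\<bar> = 1\<close>, the value \<open>card B\<close> forces \<open>e y b = 1\<close> for every \<open>b \<in> B\<close>, and then
  \<open>e y\<close> is constant along the edges of the connected Cayley graph.\<close>

lemma spectrum_eq_card_iff:
  assumes conn: "Digraph_Component.connected (with_proj (cayley B))"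
  shows "spectrum B y = real (card B) \<longleftrightarrow> y = 0"
proof
  assume "spectrum B y = real (card B)"
  then have "(\<Sum>b\<in>B. 1 - Re (e y b)) = 0"
    by (simp add: spectrum_def sum_subtractf)
  moreover have le: "Re (e y b) \<le> 1" for b
    using complex_Re_le_cmod[of "e y b"] by simp
  ultimately have "\<forall>b\<in>B. Re (e y b) = 1"
    by (subst (asm) sum_nonneg_eq_0_iff) auto
  then have one: "e y b = 1" if "b \<in> B" for b
    using that norm_eq_1[of y b] by (auto simp: complex_eq_iff cmod_def)
  have along_arc: "e y i = e y j" if "j - i \<in> B" for i j
    using one[OF that] nonzero[of y i] by (simp add: diff_right minus_right field_simps)
  have "e y x = 1" for x
  proof -
    have "0 \<rightarrow>\<^sup>*\<^bsub>with_proj (mk_symmetric (with_proj (cayley B)))\<^esub> x"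
      using conn by (simp add: connected_def strongly_connected_def cayley_def)
    then show ?thesis
      unfolding reachable_def
    proof (induction rule: rtrancl_on_induct)
      case (step z x)
      then have "x - z \<in> B \<or> z - x \<in> B"
        by (auto simp: parcs_mk_symmetric cayley_def)
      then show ?case
        using along_arc[of x z] along_arc[of z x] step.IH by auto
    qed simp
  qed
  then show "y = 0" by (rule nondegenerate)
qed (simp add: spectrum_def)

text \<open>The minimum polynomial has simple roots, namely the eigenvalues, so that the quotient \<open>q\<close> vanishes
  at all of them except \<open>card B\<close>; by connectedness \<open>card B\<close> belongs to \<open>y = 0\<close> only.\<close>

lemma quotient_polynomial:
  assumes B: "B = uminus ` B" and p: "minimum_polynomial (cayley_matrix B) p"
    and conn: "Digraph_Component.connected (with_proj (cayley B))"
    and q: "q = p div [:- real (card B), 1:]"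
  shows "poly q (real (card B)) \<noteq> 0"
    and "poly q (spectrum B y) = (if y = 0 then poly q (real (card B)) else 0)"
    and "degree q = degree p - 1"
proof -
  note ann = matrix_poly_eq_0_iff_spectrum[OF B]
  have p0: "p \<noteq> 0" and roots: "poly p (spectrum B y) = 0" for y
    using p ann by (auto simp: minimum_polynomial_def)
  have top: "spectrum B 0 = real (card B)"
    by (simp add: spectrum_eq_card_iff[OF conn])
  have pq: "p = [:- real (card B), 1:] * q"
    using roots[of 0] unfolding q top poly_eq_0_iff_dvd by (simp only: dvd_mult_div_cancel)
  then have "q \<noteq> 0"
    using p0 by auto
  have deg: "degree p = Suc (degree q)"
    using \<open>q \<noteq> 0\<close> by (subst pq, subst degree_mult_eq) auto
  then show "degree q = degree p - 1" by simp
  have other: "poly q (spectrum B y) = 0" if "y \<noteq> 0" for y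
    using roots[of y] that spectrum_eq_card_iff[OF conn, of y] by (subst (asm) pq) simp
  then show "poly q (spectrum B y) = (if y = 0 then poly q (real (card B)) else 0)"
    by (simp add: top)
  show "poly q (real (card B)) \<noteq> 0"
  proof
    assume "poly q (real (card B)) = 0"
    then have "matrix_poly q (cayley_matrix B) = 0"
      unfolding ann using other top by (metis (no_types))
    then have "degree p \<le> degree q"
      using p \<open>q \<noteq> 0\<close> by (simp add: minimum_polynomial_def)
    then show False using deg by simp
  qed
qed

text \<open>The matrix \<open>q(A)\<close> is constant: its transform is concentrated at \<open>0\<close>.\<close>

lemma poly_conv_quotient:
  fixes B :: "'a set"
  assumes B: "B = uminus ` B" and p: "minimum_polynomial (cayley_matrix B) p"
    and conn: "Digraph_Component.connected (with_proj (cayley B))"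
    and q: "q = p div [:- real (card B), 1:]"
  shows "real CARD('a) * poly_conv q B d = poly q (real (card B))"
proof -
  have "complex_of_real (real CARD('a) * poly_conv q B d)
      = (\<Sum>y\<in>UNIV. of_real (poly q (spectrum B y)) * e y d)"
    using dft_inversion[of "\<lambda>d. of_real (poly_conv q B d)" d]
    by (simp add: dft_poly_conv[OF B])
  also have "\<dots> = (\<Sum>y\<in>(UNIV::'a set). if y = 0 then of_real (poly q (real (card B))) else 0)"
    by (rule sum.cong[OF refl]) (auto simp add: quotient_polynomial(2)[OF assms])
  also have "\<dots> = of_real (poly q (real (card B)))"
    by simp
  finally show ?thesis
    using of_real_eq_iff by blast
qed

text \<open>The rows of the character table are eigenvectors.  An eigenvector for any other value \<open>c\<close>
  would have vanishing transform, because \<open>A\<close> acts on transforms as multiplication by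
  \<open>dft (indicator B)\<close>.\<close>

lemma eigenvalues_cayley:
  fixes B :: "'a set"
  shows "{c::complex. eigenvalue_of (cayley_matrix B) c} = range (dft (indicator B))"
proof (intro set_eqI iffI)
  fix c :: complex
  assume "c \<in> {c. eigenvalue_of (cayley_matrix B) c}"
  then obtain v where v: "v \<noteq> 0" "cayley_matrix B *v v = c *s v"
    by (auto simp: eigenvalue_of_def)
  have act: "(\<Sum>a\<in>UNIV. indicator B a * v $ (i - a)) = c * v $ i" for i
  proof -
    have "(\<Sum>a\<in>UNIV. indicator B a * v $ (i - a)) = (\<Sum>j\<in>UNIV. indicator B (i - j) * v $ j)"
      by (rule sum.reindex_bij_witness[of _ "\<lambda>j. i - j" "\<lambda>j. i - j"]) auto
    also have "\<dots> = (cayley_matrix B *v v) $ i"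
      by (simp add: matrix_vector_mult_def cayley_matrix_def)
    finally show ?thesis by (simp add: v)
  qed
  have "c * dft (($) v) y = dft (indicator B) y * dft (($) v) y" for y
  proof -
    have "c * dft (($) v) y = dft (\<lambda>i. c * v $ i) y"
      by (simp add: dft_def sum_distrib_left mult_ac)
    then show ?thesis
      by (simp only: dft_convolution act[symmetric])
  qed
  moreover obtain y where "dft (($) v) y \<noteq> 0"
    using v(1) dft_eq_0_iff[of "($) v"] by (auto simp: vec_eq_iff)
  ultimately show "c \<in> range (dft (indicator B))"
    by auto
next
  fix c :: complex
  assume "c \<in> range (dft (indicator B))"
  then obtain y where c: "c = dft (indicator B) y" by auto
  define v where "v = (\<chi> i. e y i)"
  have "v \<noteq> 0"
    using nonzero by (auto simp: v_def vec_eq_iff)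
  moreover have "cayley_matrix B *v v = c *s v"
  proof (rule vec_eq_iff[THEN iffD2], rule allI)
    fix i
    have "(cayley_matrix B *v v) $ i = (\<Sum>j\<in>UNIV. indicator B (i - j) * e y j)"
      by (simp add: matrix_vector_mult_def cayley_matrix_def v_def)
    also have "\<dots> = (\<Sum>a\<in>UNIV. indicator B a * e y (i - a))"
      by (rule sum.reindex_bij_witness[of _ "\<lambda>j. i - j" "\<lambda>j. i - j"]) auto
    also have "\<dots> = c * e y i"
      by (simp add: c dft_def diff_right sum_distrib_left sum_distrib_right mult_ac)
    finally show "(cayley_matrix B *v v) $ i = (c *s v) $ i"
      by (simp add: v_def)
  qed
  ultimately show "c \<in> {c. eigenvalue_of (cayley_matrix B) c}"
    by (auto simp: eigenvalue_of_def)
qed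

end

text \<open>Commutativity of the ring makes the pairing symmetric, and injectivity of \<open>x \<mapsto> \<chi>\<^sub>x\<close> makes it
  nondegenerate.\<close>

lemma bicharacter_generating_character:
  assumes "ring_structure mul u" "generating_character mul \<xi>"
  shows "nondegenerate_bicharacter (\<lambda>x y. \<xi> (mul x y))"
proof -
  have comm: "mul x y = mul y x" for x y
    using assms(1) unfolding ring_structure_def comm_monoid_def
    by (metis abel_semigroup.commute)
  have inj: "inj (\<lambda>x y. \<xi> (mul x y))" and ch: "\<xi> \<in> characters"
    and left: "\<xi> (mul (x + x') y) = \<xi> (mul x y) * \<xi> (mul x' y)" for x x' y
    using assms(2) unfolding generating_character_def bij_betw_def by auto
  show ?thesis
  proof
    fix x y z
    show "\<xi> (mul x y) \<noteq> 0" using ch by (simp add: characters_def)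
    show "\<xi> (mul x y) = \<xi> (mul y x)" by (simp add: comm)
    show "\<xi> (mul x (y + z)) = \<xi> (mul x y) * \<xi> (mul x z)"
      using left[of y z x] by (simp add: comm)
  next
    fix x assume "\<And>y. \<xi> (mul x y) = 1"
    moreover have "\<xi> (mul 0 y) = 1" for y
      using left[of 0 0 y] ch by (simp add: characters_def)
    ultimately have "(\<lambda>y. \<xi> (mul x y)) = (\<lambda>y. \<xi> (mul 0 y))" by simp
    then show "x = 0" by (rule injD[OF inj])
  qed
qed

section \<open>Weighted homomorphism sums\<close>

text \<open>
  For an edge weight \<open>w\<close> the numbers below are the (pinned) homomorphism numbers into the weighted
  graph on the group whose arc from \<open>i\<close> to \<open>j\<close> has weight \<open>w (j - i)\<close>.  Tensions use
  \<open>w = indicator B\<close>, the Cayley graph itself; flows use \<open>w = spectrum B\<close>, the dual weighted graph.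
\<close>

definition arc_weight :: "('a::ab_group_add \<Rightarrow> 'c::comm_semiring_1) \<Rightarrow> ('v,'e) pre_digraph \<Rightarrow> ('v \<Rightarrow> 'a) \<Rightarrow> 'c" where
  "arc_weight w G f = (\<Prod>e\<in>arcs G. w (f (head G e) - f (tail G e)))"

definition hom_sum :: "('a::ab_group_add \<Rightarrow> 'c::comm_semiring_1) \<Rightarrow> ('v,'e) pre_digraph \<Rightarrow> 'c" where
  "hom_sum w G = (\<Sum>f\<in>verts G \<rightarrow>\<^sub>E UNIV. arc_weight w G f)"

definition pinned_hom_sum ::
    "('a::ab_group_add \<Rightarrow> 'c::comm_semiring_1) \<Rightarrow> ('v,'e) lgraph \<Rightarrow> 'a \<Rightarrow> 'a \<Rightarrow> 'c" where
  "pinned_hom_sum w X a b =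
     (\<Sum>f\<in>{f \<in> verts (unlabel X) \<rightarrow>\<^sub>E UNIV. f (lab1 X) = a \<and> f (lab2 X) = b}. arc_weight w (unlabel X) f)"

lemma two_labelledD:
  assumes "two_labelled X"
  shows "wf_digraph (unlabel X)" "finite (verts (unlabel X))" "finite (arcs (unlabel X))"
    "lab1 X \<in> verts (unlabel X)" "lab2 X \<in> verts (unlabel X)"
  using assms unfolding two_labelled_def
  by (auto simp: fin_digraph_def fin_digraph_axioms_def)

section \<open>Products of labelled graphs\<close>

text \<open>A function on the disjoint union that agrees on equally labelled vertices factors through the
  product.  Besides gluing homomorphisms, this separates classes without computing them.\<close>

lemma glue_class_eq_imp:
  fixes X :: "('v,'e) lgraph" and Y :: "('w,'f) lgraph"
  assumes "glue_class X Y z = glue_class X Y z'"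
    and "h (Inl (lab1 X)) = h (Inr (lab1 Y))" "h (Inl (lab2 X)) = h (Inr (lab2 Y))"
  shows "h z = h z'"
proof -
  define R :: "(('v + 'w) \<times> ('v + 'w)) set" where "R = {(Inl (lab1 X), Inr (lab1 Y)), (Inl (lab2 X), Inr (lab2 Y))}"
  have "z' \<in> glue_class X Y z'"
    by (simp add: glue_class_def)
  then have "(z, z') \<in> (R \<union> R\<inverse>)\<^sup>*"
    unfolding assms(1)[symmetric] by (simp add: glue_class_def R_def Let_def)
  then show ?thesis
  proof induction
    case (step y z)
    then show ?case using assms(2,3) by (auto simp: R_def)
  qed simp
qed

lemma glue_class_step:
  fixes X :: "('v,'e) lgraph" and Y :: "('w,'f) lgraph"
  assumes "(z, z') \<in> {(Inl (lab1 X), Inr (lab1 Y)), (Inl (lab2 X), Inr (lab2 Y))}"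
  shows "glue_class X Y z = glue_class X Y z'"
proof -
  define R :: "(('v + 'w) \<times> ('v + 'w)) set" where "R = {(Inl (lab1 X), Inr (lab1 Y)), (Inl (lab2 X), Inr (lab2 Y))}"
  have sym: "(R \<union> R\<inverse>)\<^sup>* `` {x} \<subseteq> (R \<union> R\<inverse>)\<^sup>* `` {y}" if "(y, x) \<in> R \<union> R\<inverse>" for x y
    using that by (auto intro: converse_rtrancl_into_rtrancl)
  have "(z, z') \<in> R \<union> R\<inverse>" "(z', z) \<in> R \<union> R\<inverse>"
    using assms by (auto simp: R_def)
  then show ?thesis
    unfolding glue_class_def Let_def R_def[symmetric] by (intro subset_antisym sym)
qed

lemma glue_lab1: "glue_class X Y (Inr (lab1 Y)) = glue_class X Y (Inl (lab1 X))"
  by (rule glue_class_step[symmetric]) simp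

lemma glue_lab2: "glue_class X Y (Inr (lab2 Y)) = glue_class X Y (Inl (lab2 X))"
  by (rule glue_class_step[symmetric]) simp

lemma unlabel_prod_simps [simp]:
  "verts (unlabel (lgraph_prod X Y)) = glue_class X Y ` (verts (unlabel X) <+> verts (unlabel Y))"
  "arcs (unlabel (lgraph_prod X Y)) = arcs (unlabel X) <+> arcs (unlabel Y)"
  "tail (unlabel (lgraph_prod X Y)) = glue_class X Y \<circ> map_sum (tail (unlabel X)) (tail (unlabel Y))"
  "head (unlabel (lgraph_prod X Y)) = glue_class X Y \<circ> map_sum (head (unlabel X)) (head (unlabel Y))"
  by (simp_all add: lgraph_prod_def)

lemma fin_digraph_prod:
  assumes "two_labelled X" "two_labelled Y"
  shows "fin_digraph (unlabel (lgraph_prod X Y))"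
proof -
  note X = two_labelledD[OF assms(1)] and Y = two_labelledD[OF assms(2)]
  show ?thesis
    using X Y by unfold_locales (auto simp: wf_digraph_def)
qed

text \<open>A map on the vertices of the product is the same as a pair of maps on the factors that agree at
  the labels; grouping these pairs by the values \<open>a\<close> and \<open>b\<close> at the two labels gives the
  product formula.\<close>

theorem hom_sum_prod:
  fixes w :: "'a::{ab_group_add,finite} \<Rightarrow> 'c::comm_semiring_1"
    and X :: "('v,'e) lgraph" and Y :: "('w,'f) lgraph"
  assumes "two_labelled X" "two_labelled Y"
  shows "hom_sum w (unlabel (lgraph_prod X Y))
       = (\<Sum>a\<in>UNIV. \<Sum>b\<in>UNIV. pinned_hom_sum w X a b * pinned_hom_sum w Y a b)"
proof -
  note X = two_labelledD[OF assms(1)] and Y = two_labelledD[OF assms(2)]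
  let ?G = "unlabel (lgraph_prod X Y)" and ?VX = "verts (unlabel X)" and ?VY = "verts (unlabel Y)"
  let ?cl = "glue_class X Y"
  define S where "S = (\<lambda>(a, b). {f \<in> ?VX \<rightarrow>\<^sub>E (UNIV::'a set). f (lab1 X) = a \<and> f (lab2 X) = b}
     \<times> {f \<in> ?VY \<rightarrow>\<^sub>E (UNIV::'a set). f (lab1 Y) = a \<and> f (lab2 Y) = b})"
  have "finite (?VX \<rightarrow>\<^sub>E (UNIV::'a set))" "finite (?VY \<rightarrow>\<^sub>E (UNIV::'a set))"
    using X Y by (auto intro: finite_PiE)
  then have finS: "finite (S ab)" for ab
    by (auto simp: S_def split: prod.split)
  define split where "split = (\<lambda>f::('v + 'w) set \<Rightarrow> 'a.
     (restrict (f \<circ> ?cl \<circ> Inl) ?VX, restrict (f \<circ> ?cl \<circ> Inr) ?VY))"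
  \<comment> \<open>Any representative of the class may be chosen, by the compatibility at the labels.\<close>
  define join where "join = (\<lambda>(f, g::'w \<Rightarrow> 'a). restrict (\<lambda>C. case_sum f g (SOME z. ?cl z = C)) (verts ?G))"
  have join_cl: "join (f, g) (?cl z) = case_sum f g z"
    if "(f, g) \<in> S (a, b)" "z \<in> ?VX <+> ?VY" for f g a b z
  proof -
    have "?cl (SOME z'. ?cl z' = ?cl z) = ?cl z"
      by (rule someI) simp
    then have "case_sum f g (SOME z'. ?cl z' = ?cl z) = case_sum f g z"
      by (rule glue_class_eq_imp) (use that in \<open>auto simp: S_def\<close>)
    then show ?thesis
      using that(2) by (simp add: join_def)
  qed
  have "(\<Sum>a\<in>UNIV. \<Sum>b\<in>UNIV. pinned_hom_sum w X a b * pinned_hom_sum w Y a b)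
      = (\<Sum>ab\<in>UNIV. \<Sum>fg\<in>S ab. arc_weight w (unlabel X) (fst fg) * arc_weight w (unlabel Y) (snd fg))"
    unfolding pinned_hom_sum_def sum_product sum.cartesian_product
    by (simp add: UNIV_Times_UNIV[symmetric] S_def case_prod_beta del: UNIV_Times_UNIV)
  also have "\<dots> = (\<Sum>fg\<in>(\<Union>ab. S ab). arc_weight w (unlabel X) (fst fg) * arc_weight w (unlabel Y) (snd fg))"
    by (rule sum.UNION_disjoint[symmetric]) (use finS in \<open>auto simp: S_def\<close>)
  also have "\<dots> = (\<Sum>f\<in>verts ?G \<rightarrow>\<^sub>E UNIV. arc_weight w ?G f)"
  proof (rule sum.reindex_bij_witness[of _ split join])
    fix fg assume "fg \<in> (\<Union>ab. S ab)"
    then obtain ab where "fg \<in> S ab" by blast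
    then obtain f g a b where fg: "fg = (f, g)" "(f, g) \<in> S (a, b)"
      by (cases fg; cases ab) auto
    have join_fg: "v \<in> ?VX \<Longrightarrow> join (f, g) (?cl (Inl v)) = f v"
      "v' \<in> ?VY \<Longrightarrow> join (f, g) (?cl (Inr v')) = g v'" for v v'
      using join_cl[OF fg(2), of "Inl v"] join_cl[OF fg(2), of "Inr v'"] by auto
    show "join fg \<in> verts ?G \<rightarrow>\<^sub>E UNIV"
      by (simp add: fg(1) join_def)
    have "restrict (join fg \<circ> ?cl \<circ> Inl) ?VX = f" "restrict (join fg \<circ> ?cl \<circ> Inr) ?VY = g"
      using fg(2) by (auto simp: fg(1) join_fg S_def fun_eq_iff PiE_def extensional_def)
    then show "split (join fg) = fg"
      by (simp add: split_def fg(1))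
    have "arc_weight w ?G (join fg)
        = (\<Prod>e\<in>arcs (unlabel X). w (join fg (?cl (Inl (head (unlabel X) e))) - join fg (?cl (Inl (tail (unlabel X) e)))))
        * (\<Prod>e\<in>arcs (unlabel Y). w (join fg (?cl (Inr (head (unlabel Y) e))) - join fg (?cl (Inr (tail (unlabel Y) e)))))"
      using X Y by (simp add: arc_weight_def prod.Plus)
    also have "\<dots> = arc_weight w (unlabel X) f * arc_weight w (unlabel Y) g"
      using X(1) Y(1) by (simp add: arc_weight_def fg(1) join_fg wf_digraph_def cong: prod.cong)
    finally show "arc_weight w ?G (join fg) = arc_weight w (unlabel X) (fst fg) * arc_weight w (unlabel Y) (snd fg)"
      by (simp add: fg(1))
  next
    fix f :: "('v + 'w) set \<Rightarrow> 'a" assume f: "f \<in> verts ?G \<rightarrow>\<^sub>E UNIV"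
    have S: "split f \<in> S (f (?cl (Inl (lab1 X))), f (?cl (Inl (lab2 X))))"
      using X Y by (simp add: split_def S_def glue_lab1 glue_lab2)
    then show "split f \<in> (\<Union>ab. S ab)" by blast
    show "join (split f) = f"
    proof
      fix C
      show "join (split f) C = f C"
      proof (cases "C \<in> verts ?G")
        case True
        then obtain z where z: "C = ?cl z" "z \<in> ?VX <+> ?VY" by auto
        have "join (split f) C = case_sum (fst (split f)) (snd (split f)) z"
          using join_cl[of "fst (split f)" "snd (split f)" _ _ z] S z by simp
        also have "\<dots> = f C"
          using z by (auto simp: split_def)
        finally show ?thesis .
      next
        case False
        then show ?thesis
          using f by (simp add: join_def case_prod_beta PiE_def extensional_def)
      qed
    qed
  qed
  finally show ?thesis by (simp add: hom_sum_def)
qed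

text \<open>Here \<open>V\<close> is a proposed transversal of the classes inside \<open>X\<close>, and \<open>h\<close> is a function on the
  disjoint union, compatible with the gluing, which shows that distinct members of \<open>V\<close> are not
  identified.\<close>

lemma card_verts_prod:
  assumes "two_labelled X" "two_labelled Y" "V \<subseteq> verts (unlabel X)"
    and "inj_on (\<lambda>v. h (Inl v)) V"
    and "h (Inl (lab1 X)) = h (Inr (lab1 Y))" "h (Inl (lab2 X)) = h (Inr (lab2 Y))"
    and "\<And>z. z \<in> verts (unlabel X) <+> verts (unlabel Y) \<Longrightarrow> glue_class X Y z \<in> (\<lambda>v. glue_class X Y (Inl v)) ` V"
  shows "card (verts (unlabel (lgraph_prod X Y))) = card V"
proof -
  have "inj_on (\<lambda>v. glue_class X Y (Inl v)) V"
  proof (rule inj_onI)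
    fix v v' assume "v \<in> V" "v' \<in> V" "glue_class X Y (Inl v) = glue_class X Y (Inl v')"
    then show "v = v'"
      using glue_class_eq_imp[of X Y "Inl v" "Inl v'" h] assms(4-6) by (auto dest: inj_onD)
  qed
  moreover have "verts (unlabel (lgraph_prod X Y)) = (\<lambda>v. glue_class X Y (Inl v)) ` V"
    using assms(3,7) by auto
  ultimately show ?thesis
    by (simp add: card_image)
qed

section \<open>The building blocks of the contractors\<close>

lemma two_labelled_K1: "two_labelled K1"
  unfolding two_labelled_def K1_def by (auto; unfold_locales; auto)

lemma two_labelled_parallel_graph: "two_labelled (parallel_graph k)"
  unfolding two_labelled_def parallel_graph_def by (auto; unfold_locales; auto)

lemma two_labelled_K2_bar: "two_labelled K2_bar"
  using two_labelled_parallel_graph[of 0] by (simp add: parallel_graph_0)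

lemma two_labelled_path_graph: "two_labelled (path_graph k)"
  unfolding two_labelled_def path_graph_def by (auto; unfold_locales; auto)

lemma pinned_hom_sum_K1: "pinned_hom_sum w K1 a b = (if a = b then 1 else 0)"
proof -
  have "{f \<in> {0} \<rightarrow>\<^sub>E UNIV. f 0 = a \<and> f 0 = b} = (if a = b then {restrict (\<lambda>_. a) {0::nat}} else {})"
    by (auto simp: fun_eq_iff PiE_def extensional_def)
  then show ?thesis
    by (simp add: pinned_hom_sum_def K1_def arc_weight_def)
qed

lemma pinned_hom_sum_parallel_graph: "pinned_hom_sum w (parallel_graph k) a b = w (b - a) ^ k"
proof -
  have "{f \<in> {0,1} \<rightarrow>\<^sub>E UNIV. f 0 = a \<and> f 1 = b} = {restrict (\<lambda>i. if i = 0 then a else b) {0,1::nat}}"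
    by (auto simp: fun_eq_iff PiE_def extensional_def)
  then show ?thesis
    by (simp add: pinned_hom_sum_def parallel_graph_def arc_weight_def del: One_nat_def)
qed

lemma pinned_hom_sum_K2_bar: "pinned_hom_sum w K2_bar a b = 1"
  using pinned_hom_sum_parallel_graph[of w 0] by (simp add: parallel_graph_0)

text \<open>A walk of length \<open>k + 1\<close> from \<open>a\<close> to \<open>b\<close> is a walk of length \<open>k\<close> from \<open>a\<close> to some \<open>c\<close> followed by a
  step from \<open>c\<close> to \<open>b\<close>.\<close>

lemma pinned_hom_sum_path_graph:
  fixes w :: "'a::{ab_group_add,finite} \<Rightarrow> 'c::comm_semiring_1"
  shows "pinned_hom_sum w (path_graph k) a b = conv_power w k (b - a)"
proof -
  define F where "F = (\<lambda>k b. {f \<in> {0..k::nat} \<rightarrow>\<^sub>E (UNIV::'a set). f 0 = a \<and> f k = b})"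
  have "(\<Sum>f\<in>F k b. \<Prod>i<k. w (f (Suc i) - f i)) = conv_power w k (b - a)"
  proof (induction k arbitrary: b)
    case 0
    have "F 0 b = (if b = a then {restrict (\<lambda>_. a) {0}} else {})"
      by (auto simp: F_def fun_eq_iff PiE_def extensional_def)
    then show ?case by simp
  next
    case (Suc k)
    define G where "G = {g \<in> {0..k} \<rightarrow>\<^sub>E (UNIV::'a set). g 0 = a}"
    have "finite ({0..k} \<rightarrow>\<^sub>E (UNIV::'a set))"
      by (intro finite_PiE) auto
    then have "finite G" by (auto simp: G_def)
    have F: "F k c = {g \<in> G. g k = c}" for c
      by (auto simp: F_def G_def)
    have "(\<Sum>f\<in>F (Suc k) b. \<Prod>i<Suc k. w (f (Suc i) - f i))
        = (\<Sum>g\<in>G. (\<Prod>i<k. w (g (Suc i) - g i)) * w (b - g k))"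
    proof (rule sum.reindex_bij_witness[of _ "\<lambda>g. g(Suc k := b)" "\<lambda>f. restrict f {0..k}"])
      fix f assume f: "f \<in> F (Suc k) b"
      then show "(restrict f {0..k})(Suc k := b) = f"
        by (auto simp: F_def fun_eq_iff PiE_def extensional_def)
      show "restrict f {0..k} \<in> G"
        using f by (auto simp: F_def G_def)
      have "(\<Prod>i<k. w (restrict f {0..k} (Suc i) - restrict f {0..k} i)) = (\<Prod>i<k. w (f (Suc i) - f i))"
        by (intro prod.cong) auto
      then show "(\<Prod>i<k. w (restrict f {0..k} (Suc i) - restrict f {0..k} i)) * w (b - restrict f {0..k} k)
          = (\<Prod>i<Suc k. w (f (Suc i) - f i))"
        using f by (simp add: F_def)
    next
      fix g assume g: "g \<in> G"
      then show "restrict (g(Suc k := b)) {0..k} = g"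
        by (auto simp: G_def fun_eq_iff PiE_def extensional_def)
      show "g(Suc k := b) \<in> F (Suc k) b"
        using g by (auto simp: F_def G_def PiE_def extensional_def)
    qed
    also have "\<dots> = (\<Sum>c\<in>UNIV. \<Sum>g\<in>{g \<in> G. g k = c}. (\<Prod>i<k. w (g (Suc i) - g i)) * w (b - g k))"
      by (rule sum.group[symmetric]) (use \<open>finite G\<close> in auto)
    also have "\<dots> = (\<Sum>c\<in>UNIV. w (b - c) * (\<Sum>g\<in>F k c. \<Prod>i<k. w (g (Suc i) - g i)))"
      unfolding F by (intro sum.cong refl) (simp add: sum_distrib_left mult.commute)
    also have "\<dots> = (\<Sum>c\<in>UNIV. w (b - c) * conv_power w k (c - a))"
      by (simp add: Suc)
    also have "\<dots> = conv_power w (Suc k) (b - a)"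
      unfolding conv_power.simps
      by (rule sum.reindex_bij_witness[of _ "\<lambda>c. b - c" "\<lambda>c. b - c"]) (auto simp: algebra_simps)
    finally show ?case .
  qed
  then show ?thesis
    by (simp add: pinned_hom_sum_def path_graph_def arc_weight_def F_def atLeast0LessThan)
qed

lemma card_verts_prod_parallel_graph:
  assumes "two_labelled X" "lab1 X \<noteq> lab2 X"
  shows "card (verts (unlabel (lgraph_prod X (parallel_graph k)))) = card (verts (unlabel X))"
proof (rule card_verts_prod[where h = "case_sum id (\<lambda>i. if i = 0 then lab1 X else lab2 X)"])
  fix z assume z: "z \<in> verts (unlabel X) <+> verts (unlabel (parallel_graph k))"
  show "glue_class X (parallel_graph k) z
      \<in> (\<lambda>v. glue_class X (parallel_graph k) (Inl v)) ` verts (unlabel X)"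
    using z two_labelledD(4,5)[OF assms(1)]
      glue_lab1[of X "parallel_graph k"] glue_lab2[of X "parallel_graph k"]
    by (auto simp: parallel_graph_def)
qed (use assms in \<open>auto simp: two_labelled_parallel_graph, auto simp: parallel_graph_def\<close>)

lemma card_verts_prod_K1:
  assumes "two_labelled X" "lab1 X \<noteq> lab2 X"
  shows "Suc (card (verts (unlabel (lgraph_prod X K1)))) = card (verts (unlabel X))"
proof -
  have "card (verts (unlabel (lgraph_prod X K1))) = card (verts (unlabel X) - {lab2 X})"
  proof (rule card_verts_prod[where h = "case_sum (\<lambda>v. if v = lab2 X then lab1 X else v) (\<lambda>_. lab1 X)"])
    fix z assume z: "z \<in> verts (unlabel X) <+> verts (unlabel K1)"
    have "glue_class X K1 (Inl (lab2 X)) = glue_class X K1 (Inl (lab1 X))"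
      using glue_lab1[of X K1] glue_lab2[of X K1] by (simp add: K1_def)
    then show "glue_class X K1 z \<in> (\<lambda>v. glue_class X K1 (Inl v)) ` (verts (unlabel X) - {lab2 X})"
      using z two_labelledD(4)[OF assms(1)] assms(2) glue_lab1[of X K1]
      by (cases "z = Inl (lab2 X)") (auto simp: K1_def)
  qed (use assms in \<open>auto simp: two_labelled_K1 inj_on_def\<close>)
  then show ?thesis
    by (simp only: card_Suc_Diff1[OF two_labelledD(2,5)[OF assms(1)]])
qed

section \<open>Tensions\<close>

lemma mk_symmetric_reachable_invariant:
  assumes "u \<rightarrow>\<^sup>*\<^bsub>with_proj (mk_symmetric G)\<^esub> v"
    and "\<And>e. e \<in> arcs G \<Longrightarrow> f (head G e) = f (tail G e)"
  shows "f u = f v"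
  using assms(1) unfolding reachable_def
proof (induction rule: rtrancl_on_induct)
  case (step y z)
  then show ?case using assms(2) by (auto simp: parcs_mk_symmetric)
qed simp

text \<open>The maps that are constant along every arc are the potentials of the zero tension.  They
  correspond to arbitrary maps on the set of components.\<close>

lemma card_locally_constant:
  fixes G :: "('v,'e) pre_digraph"
  assumes "fin_digraph G"
  shows "card {f \<in> verts G \<rightarrow>\<^sub>E (UNIV::'a::finite set). \<forall>e\<in>arcs G. f (head G e) = f (tail G e)}
       = CARD('a) ^ num_components G"
proof -
  interpret fin_digraph G by fact
  interpret S: pair_fin_digraph "mk_symmetric G" by (rule pair_fin_digraph_mk_symmetric)
  let ?L = "{f \<in> verts G \<rightarrow>\<^sub>E (UNIV::'a::finite set). \<forall>e\<in>arcs G. f (head G e) = f (tail G e)}"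
  have reach_sym: "v \<rightarrow>\<^sup>*\<^bsub>with_proj (mk_symmetric G)\<^esub> u" if "u \<rightarrow>\<^sup>*\<^bsub>with_proj (mk_symmetric G)\<^esub> v" for u v
    by (rule symmetric_reachable[OF symmetric_mk_symmetric that])
  have scc_eq: "S.scc_of u = S.scc_of v" if uv: "u \<rightarrow>\<^sup>*\<^bsub>with_proj (mk_symmetric G)\<^esub> v" for u v
    unfolding S.scc_of_def
    using S.reachable_trans[OF uv] S.reachable_trans[OF reach_sym[OF uv]]
      S.reachable_trans[OF _ uv] S.reachable_trans[OF _ reach_sym[OF uv]] by auto
  have scc_arc: "S.scc_of (head G e) = S.scc_of (tail G e)" if "e \<in> arcs G" for e
    using that by (intro scc_eq S.reachable_adjI) (auto simp: parcs_mk_symmetric)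
  have rep: "(SOME u. u \<in> C) \<in> C" if "C \<in> S.sccs_verts" for C
    using that by (auto simp: some_in_eq S.sccs_verts_conv_scc_of S.scc_of_empty_conv)
  have rep_reach: "v \<rightarrow>\<^sup>*\<^bsub>with_proj (mk_symmetric G)\<^esub> (SOME u. u \<in> S.scc_of v)" if "v \<in> verts G" for v
  proof -
    have "(SOME u. u \<in> S.scc_of v) \<in> S.scc_of v"
      using that by (intro rep S.scc_of_in_sccs_verts) simp
    then show ?thesis
      by (subst (asm) (2) S.scc_of_def) simp
  qed
  have scc_rep: "S.scc_of (SOME u. u \<in> C) = C" if C: "C \<in> S.sccs_verts" for C
  proof -
    obtain v where v: "v \<in> verts G" "C = S.scc_of v"
      using C by (auto simp: S.sccs_verts_conv_scc_of)
    then show ?thesis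
      using scc_eq[OF rep_reach[OF v(1)]] by simp
  qed
  have "bij_betw (\<lambda>F. restrict (\<lambda>v. F (S.scc_of v)) (verts G)) (S.sccs_verts \<rightarrow>\<^sub>E (UNIV::'a set)) ?L"
  proof (rule bij_betw_byWitness[where f' = "\<lambda>f. restrict (\<lambda>C. f (SOME u. u \<in> C)) S.sccs_verts"])
    show "\<forall>F\<in>S.sccs_verts \<rightarrow>\<^sub>E (UNIV::'a set).
        restrict (\<lambda>C. restrict (\<lambda>v. F (S.scc_of v)) (verts G) (SOME u. u \<in> C)) S.sccs_verts = F"
    proof
      fix F :: "'v set \<Rightarrow> 'a" assume F: "F \<in> S.sccs_verts \<rightarrow>\<^sub>E (UNIV::'a set)"
      have "(SOME u. u \<in> C) \<in> verts G" if "C \<in> S.sccs_verts" for C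
        using rep[OF that] S.sccs_verts_subsets[OF that] by auto
      then show "restrict (\<lambda>C. restrict (\<lambda>v. F (S.scc_of v)) (verts G) (SOME u. u \<in> C)) S.sccs_verts = F"
        using F scc_rep by (auto simp: fun_eq_iff PiE_def extensional_def restrict_def)
    qed
    show "\<forall>f\<in>?L. restrict (\<lambda>v. restrict (\<lambda>C. f (SOME u. u \<in> C)) S.sccs_verts (S.scc_of v)) (verts G) = f"
    proof
      fix f assume f: "f \<in> ?L"
      have "f v = f (SOME u. u \<in> S.scc_of v)" if "v \<in> verts G" for v
        by (rule mk_symmetric_reachable_invariant[OF rep_reach[OF that]]) (use f in auto)
      then show "restrict (\<lambda>v. restrict (\<lambda>C. f (SOME u. u \<in> C)) S.sccs_verts (S.scc_of v)) (verts G) = f"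
        using f S.scc_of_in_sccs_verts by (auto simp: fun_eq_iff PiE_def extensional_def restrict_def)
    qed
    show "(\<lambda>F. restrict (\<lambda>v. F (S.scc_of v)) (verts G)) ` (S.sccs_verts \<rightarrow>\<^sub>E (UNIV::'a set)) \<subseteq> ?L"
      using scc_arc by auto
    show "(\<lambda>f. restrict (\<lambda>C. f (SOME u. u \<in> C)) S.sccs_verts) ` ?L \<subseteq> S.sccs_verts \<rightarrow>\<^sub>E (UNIV::'a set)"
      by auto
  qed
  then have "card ?L = card (S.sccs_verts \<rightarrow>\<^sub>E (UNIV::'a set))"
    by (rule bij_betw_same_card[symmetric])
  then show ?thesis
    by (simp add: card_PiE S.finite_sccs_verts num_components_def)
qed

text \<open>A homomorphism to the Cayley graph is a potential of a \<open>B\<close>-tension, and two potentials of one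
  tension differ by a map that is constant on components.\<close>

theorem hom_sum_indicator:
  fixes G :: "('v,'e) pre_digraph" and B :: "'a::{ab_group_add,finite} set"
  assumes "fin_digraph G"
  shows "(hom_sum (indicator B) G :: real)
       = real CARD('a) ^ num_components G * real (card (B_tensions B G))"
proof -
  interpret fin_digraph G by fact
  define H where "H = {f \<in> verts G \<rightarrow>\<^sub>E (UNIV::'a set). \<forall>e\<in>arcs G. f (head G e) - f (tail G e) \<in> B}"
  define L where "L = {f \<in> verts G \<rightarrow>\<^sub>E (UNIV::'a set). \<forall>e\<in>arcs G. f (head G e) = f (tail G e)}"
  define d where "d = (\<lambda>f::'v \<Rightarrow> 'a. restrict (\<lambda>e. f (head G e) - f (tail G e)) (arcs G))"
  have finV: "finite (verts G \<rightarrow>\<^sub>E (UNIV::'a set))" and finA: "finite (arcs G \<rightarrow>\<^sub>E (UNIV::'a set))"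
    by (auto intro: finite_PiE)
  have finT: "finite (B_tensions B G)"
    by (rule finite_subset[OF _ finA]) (auto simp: B_tensions_def tensions_def)
  have weight: "arc_weight (indicator B) G f
      = (if \<forall>e\<in>arcs G. f (head G e) - f (tail G e) \<in> B then 1 else 0 :: real)" for f
    by (auto simp: arc_weight_def intro!: prod_zero bexI)
  have fibre: "card {f \<in> H. d f = g} = card L" if g: "g \<in> B_tensions B G" for g
  proof -
    obtain p where p: "\<And>e. e \<in> arcs G \<Longrightarrow> g e = p (head G e) - p (tail G e)"
      using g by (auto simp: B_tensions_def tensions_def)
    have gB: "\<And>e. e \<in> arcs G \<Longrightarrow> g e \<in> B" and gE: "g \<in> extensional (arcs G)"
      using g by (auto simp: B_tensions_def tensions_def PiE_def)
    have "bij_betw (\<lambda>f. restrict (\<lambda>v. f v + p v) (verts G)) L {f \<in> H. d f = g}"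
    proof (rule bij_betw_byWitness[where f' = "\<lambda>f. restrict (\<lambda>v. f v - p v) (verts G)"])
      show "(\<lambda>f. restrict (\<lambda>v. f v + p v) (verts G)) ` L \<subseteq> {f \<in> H. d f = g}"
        using p gB gE
        by (auto simp: L_def H_def d_def fun_eq_iff extensional_def restrict_def)
      show "(\<lambda>f. restrict (\<lambda>v. f v - p v) (verts G)) ` {f \<in> H. d f = g} \<subseteq> L"
      proof clarify
        fix f assume f: "f \<in> H" "g = d f"
        have "f (head G e) - p (head G e) = f (tail G e) - p (tail G e)" if "e \<in> arcs G" for e
          using p[OF that] that f(2) by (simp add: d_def algebra_simps)
        then show "restrict (\<lambda>v. f v - p v) (verts G) \<in> L"
          by (auto simp: L_def)
      qed
    qed (auto simp: L_def H_def fun_eq_iff PiE_def extensional_def)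
    then show ?thesis
      by (rule bij_betw_same_card[symmetric])
  qed
  have "hom_sum (indicator B) G = (\<Sum>f\<in>H. 1::real)"
    unfolding hom_sum_def weight by (simp add: sum.If_cases finV H_def Int_def)
  also have "\<dots> = (\<Sum>g\<in>B_tensions B G. \<Sum>f\<in>{f \<in> H. d f = g}. 1)"
    by (rule sum.group[symmetric])
      (use finT finV in \<open>auto simp: H_def d_def B_tensions_def tensions_def\<close>)
  also have "\<dots> = real (card (B_tensions B G)) * real (card L)"
    by (simp add: fibre)
  also have "card L = CARD('a) ^ num_components G"
    unfolding L_def by (rule card_locally_constant) fact
  finally show ?thesis
    by simp
qed

section \<open>Flows\<close>

definition excess :: "('v,'e) pre_digraph \<Rightarrow> ('e \<Rightarrow> 'a::ab_group_add) \<Rightarrow> 'v \<Rightarrow> 'a" where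
  "excess G g v = (\<Sum>e\<in>{e \<in> arcs G. head G e = v}. g e) - (\<Sum>e\<in>{e \<in> arcs G. tail G e = v}. g e)"

text \<open>Loops, which the definition of a flow leaves out, enter the excess twice with opposite signs.\<close>

lemma flows_excess:
  fixes G :: "('v,'e) pre_digraph"
  assumes "finite (arcs G)"
  shows "flows G = {g \<in> arcs G \<rightarrow>\<^sub>E UNIV. \<forall>v\<in>verts G. excess G g v = 0}"
proof -
  have "excess G g v = (\<Sum>e\<in>{e \<in> arcs G. head G e = v \<and> tail G e \<noteq> v}. g e)
      - (\<Sum>e\<in>{e \<in> arcs G. tail G e = v \<and> head G e \<noteq> v}. g e)" for g :: "'e \<Rightarrow> 'a::ab_group_add" and v
  proof -
    have h: "{e \<in> arcs G. head G e = v} = {e \<in> arcs G. head G e = v \<and> tail G e \<noteq> v}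
        \<union> {e \<in> arcs G. head G e = v \<and> tail G e = v}"
     and t: "{e \<in> arcs G. tail G e = v} = {e \<in> arcs G. tail G e = v \<and> head G e \<noteq> v}
        \<union> {e \<in> arcs G. head G e = v \<and> tail G e = v}"
      by auto
    show ?thesis
      unfolding excess_def h t
      by (subst (1 2) sum.union_disjoint) (use assms in auto)
  qed
  then show ?thesis
    by (simp add: flows_def)
qed

text \<open>
  Duality between flows and tensions.  Expanding every arc weight as a character sum over \<open>B\<close> turns
  the left-hand side into a sum over pairs of a vertex map \<open>f\<close> and an arc map \<open>g\<close> with values in
  \<open>B\<close>.  Summation by parts collects the exponents at the vertices, where \<open>f v\<close> is paired with the
  excess of \<open>g\<close> at \<open>v\<close>; the sum over \<open>f\<close> then kills every \<open>g\<close> that is not a flow.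
\<close>

theorem (in nondegenerate_bicharacter) hom_sum_dft_indicator:
  fixes G :: "('v,'e) pre_digraph"
  assumes "fin_digraph G"
  shows "hom_sum (dft (indicator B)) G = of_nat CARD('a) ^ card (verts G) * of_nat (card (B_flows B G))"
proof -
  interpret fin_digraph G by fact
  have finF: "finite (arcs G \<rightarrow>\<^sub>E B)"
    by (auto intro: finite_PiE)
  have pairing: "(\<Prod>i\<in>arcs G. e (f (head G i) - f (tail G i)) (- g i))
      = (\<Prod>v\<in>verts G. e (f v) (- excess G g v))" for f :: "'v \<Rightarrow> 'a" and g
  proof -
    have "(\<Prod>i\<in>arcs G. e (f (head G i) - f (tail G i)) (- g i))
        = (\<Prod>i\<in>arcs G. e (f (head G i)) (- g i)) * (\<Prod>i\<in>arcs G. e (f (tail G i)) (g i))"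
      by (simp add: diff_left prod.distrib)
    also have "(\<Prod>i\<in>arcs G. e (f (head G i)) (- g i))
        = (\<Prod>v\<in>verts G. \<Prod>i\<in>{i \<in> arcs G. head G i = v}. e (f (head G i)) (- g i))"
      by (rule prod.group[symmetric]) auto
    also have "\<dots> = (\<Prod>v\<in>verts G. e (f v) (- (\<Sum>i\<in>{i \<in> arcs G. head G i = v}. g i)))"
      by (intro prod.cong refl) (simp add: sum_negf[symmetric] sum_right)
    also have "(\<Prod>i\<in>arcs G. e (f (tail G i)) (g i))
        = (\<Prod>v\<in>verts G. \<Prod>i\<in>{i \<in> arcs G. tail G i = v}. e (f (tail G i)) (g i))"
      by (rule prod.group[symmetric]) auto
    also have "\<dots> = (\<Prod>v\<in>verts G. e (f v) (\<Sum>i\<in>{i \<in> arcs G. tail G i = v}. g i))"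
      by (intro prod.cong refl) (simp add: sum_right)
    finally show ?thesis
      by (simp add: excess_def prod.distrib[symmetric] add_right[symmetric])
  qed
  have "hom_sum (dft (indicator B)) G
      = (\<Sum>f\<in>verts G \<rightarrow>\<^sub>E UNIV. \<Sum>g\<in>arcs G \<rightarrow>\<^sub>E B. \<Prod>i\<in>arcs G. e (f (head G i) - f (tail G i)) (- g i))"
    unfolding hom_sum_def arc_weight_def dft_indicator_sum by (subst prod_sum_PiE) auto
  also have "\<dots> = (\<Sum>g\<in>arcs G \<rightarrow>\<^sub>E B. \<Sum>f\<in>verts G \<rightarrow>\<^sub>E UNIV. \<Prod>v\<in>verts G. e (f v) (- excess G g v))"
    by (subst sum.swap) (simp add: pairing)
  also have "\<dots> = (\<Sum>g\<in>arcs G \<rightarrow>\<^sub>E B. \<Prod>v\<in>verts G. \<Sum>y\<in>UNIV. e y (- excess G g v))"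
    by (subst prod_sum_PiE) auto
  also have "\<dots> = (\<Sum>g\<in>arcs G \<rightarrow>\<^sub>E B. \<Prod>v\<in>verts G. if excess G g v = 0 then of_nat CARD('a) else 0)"
    by (intro sum.cong prod.cong refl) (simp add: sym[of _ "- _"] sum_character)
  also have "\<dots> = (\<Sum>g\<in>arcs G \<rightarrow>\<^sub>E B. if \<forall>v\<in>verts G. excess G g v = 0 then of_nat CARD('a) ^ card (verts G) else 0)"
    by (intro sum.cong refl) (auto intro!: prod_zero)
  also have "\<dots> = of_nat CARD('a) ^ card (verts G)
      * of_nat (card {g \<in> arcs G \<rightarrow>\<^sub>E B. \<forall>v\<in>verts G. excess G g v = 0})"
    by (simp add: sum.If_cases finF Int_def mult.commute)
  also have "{g \<in> arcs G \<rightarrow>\<^sub>E B. \<forall>v\<in>verts G. excess G g v = 0} = B_flows B G"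
    by (auto simp: B_flows_def flows_excess PiE_def)
  finally show ?thesis .
qed

corollary (in nondegenerate_bicharacter) hom_sum_spectrum:
  fixes G :: "('v,'e) pre_digraph"
  assumes "fin_digraph G" "B = uminus ` B"
  shows "hom_sum (spectrum B) G = real CARD('a) ^ card (verts G) * real (card (B_flows B G))"
proof -
  have "complex_of_real (hom_sum (spectrum B) G) = hom_sum (dft (indicator B)) G"
    by (simp add: hom_sum_def arc_weight_def dft_indicator[OF assms(2)])
  also have "\<dots> = complex_of_real (real CARD('a) ^ card (verts G) * real (card (B_flows B G)))"
    by (simp add: hom_sum_dft_indicator[OF assms(1)])
  finally show ?thesis
    using of_real_eq_iff by blast
qed

section \<open>Evaluation on quantum graphs\<close>

definition linear_extension :: "('x \<Rightarrow> real) \<Rightarrow> ('x \<Rightarrow>\<^sub>0 real) \<Rightarrow> real" where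
  "linear_extension \<phi> Z = (\<Sum>Y\<in>Poly_Mapping.keys Z. Poly_Mapping.lookup Z Y * \<phi> Y)"

lemma linear_extension_superset:
  assumes "finite S" "Poly_Mapping.keys Z \<subseteq> S"
  shows "linear_extension \<phi> Z = (\<Sum>Y\<in>S. Poly_Mapping.lookup Z Y * \<phi> Y)"
  unfolding linear_extension_def
  using assms by (intro sum.mono_neutral_left) (auto simp: in_keys_iff)

lemma linear_extension_add:
  "linear_extension \<phi> (Z + W) = linear_extension \<phi> Z + linear_extension \<phi> W"
proof -
  let ?S = "Poly_Mapping.keys Z \<union> Poly_Mapping.keys W"
  have S: "finite ?S" by simp
  show ?thesis
    unfolding linear_extension_superset[OF S Poly_Mapping.keys_add]
      linear_extension_superset[OF S Un_upper1] linear_extension_superset[OF S Un_upper2]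
    by (simp add: lookup_add algebra_simps sum.distrib)
qed

lemma linear_extension_qscale: "linear_extension \<phi> (qscale c Z) = c * linear_extension \<phi> Z"
proof -
  have lookup: "Poly_Mapping.lookup (qscale c Z) Y = c * Poly_Mapping.lookup Z Y" for Y
    by (simp add: qscale_def Poly_Mapping.map.rep_eq when_def)
  have "linear_extension \<phi> (qscale c Z)
      = (\<Sum>Y\<in>Poly_Mapping.keys Z. Poly_Mapping.lookup (qscale c Z) Y * \<phi> Y)"
    by (rule linear_extension_superset) (auto simp: in_keys_iff lookup)
  then show ?thesis
    by (simp add: linear_extension_def lookup sum_distrib_left mult.assoc)
qed

lemma linear_extension_diff:
  "linear_extension \<phi> (Z - W) = linear_extension \<phi> Z - linear_extension \<phi> W"
  using linear_extension_add[of \<phi> "Z - W" W] by simp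

lemma linear_extension_sum:
  "linear_extension \<phi> (sum f S) = (\<Sum>i\<in>S. linear_extension \<phi> (f i))"
  by (induction S rule: infinite_finite_induct)
    (simp_all add: linear_extension_add, simp_all add: linear_extension_def)

lemma linear_extension_single: "linear_extension \<phi> (Poly_Mapping.single X c) = c * \<phi> X"
  by (simp add: linear_extension_superset[of "{X}"])

lemma qeval_qprod_qof:
  "qeval h (qprod (qof X) Z) = linear_extension (\<lambda>Y. h (unlabel (lgraph_prod X Y))) Z"
proof -
  have "qeval h W = linear_extension (\<lambda>X. h (unlabel X)) W" for W
    by (simp add: qeval_def linear_extension_def)
  then have "qeval h (qprod (qof X) Z)
      = linear_extension (\<lambda>X. h (unlabel X)) (\<Sum>Y\<in>Poly_Mapping.keys Z.
          Poly_Mapping.single (lgraph_prod X Y) (Poly_Mapping.lookup Z Y))"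
    by (simp add: qprod_def)
  then show ?thesis
    by (simp add: linear_extension_sum linear_extension_single) (simp add: linear_extension_def)
qed

lemmas qeval_qprod_simps = qeval_qprod_qof linear_extension_qscale linear_extension_diff
  linear_extension_sum linear_extension_single

lemma keys_qscale: "Poly_Mapping.keys (qscale c Z) \<subseteq> Poly_Mapping.keys Z"
  by (auto simp: in_keys_iff qscale_def Poly_Mapping.map.rep_eq when_def split: if_splits)

lemma keys_sum_qscale_qof:
  "Poly_Mapping.keys (\<Sum>i\<in>S. qscale (c i) (qof (f i))) \<subseteq> f ` S"
proof -
  have "Poly_Mapping.keys (qscale (c i) (qof (f i))) \<subseteq> {f i}" for i
    using keys_qscale[of "c i" "qof (f i)"] by simp
  then show ?thesis
    by (intro order_trans[OF Poly_Mapping.keys_sum]) auto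
qed

section \<open>The contractors\<close>

text \<open>The dual weight of \<open>k\<close> parallel arcs is the \<open>k\<close>-th power of a spectral value, so the combination
  with coefficients of \<open>q\<close> has pinned weight \<open>q\<close> evaluated at that value.  When this is \<open>c\<close> on the
  diagonal and \<open>0\<close> elsewhere, it is \<open>c\<close> times the pinned weight of \<open>K1\<close>.  The factor
  \<open>n\<close> comes from the duality theorem, because \<open>K1\<close> leaves one vertex less.\<close>

theorem (in nondegenerate_bicharacter) contractor_B_flows:
  fixes B :: "'a set"
  assumes B: "B = uminus ` B" and "c \<noteq> 0"
    and q: "\<And>y. poly q (spectrum B y) = (if y = 0 then c else 0)"
  shows "contractor
      (\<lambda>G :: (('v + nat) set, 'e + nat) pre_digraph. real (card (B_flows B G)))
      (qscale (real CARD('a) / c)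
        (\<Sum>k = 0..degree q. qscale (coeff q k) (qof (parallel_graph k))))"
    (is "contractor _ ?Z")
  unfolding contractor_def
proof (intro conjI allI impI ballI)
  fix Y assume "Y \<in> Poly_Mapping.keys ?Z"
  then have "Y \<in> parallel_graph ` {0..degree q}"
    by (rule subsetD[OF order_trans[OF keys_qscale keys_sum_qscale_qof]])
  then show "two_labelled Y"
    using two_labelled_parallel_graph by auto
next
  fix X :: "('v,'e) lgraph"
  assume "two_labelled X \<and> lab1 X \<noteq> lab2 X \<and>
    (lab1 X, lab2 X) \<notin> arcs_ends (unlabel X) \<and> (lab2 X, lab1 X) \<notin> arcs_ends (unlabel X)"
  then have X: "two_labelled X" and labs: "lab1 X \<noteq> lab2 X" by auto
  let ?n = "real CARD('a)"
  let ?N = "?n ^ card (verts (unlabel X))"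
  define W where "W = pinned_hom_sum (spectrum B) X"
  define F where "F = (\<lambda>Y::(nat,nat) lgraph. real (card (B_flows B (unlabel (lgraph_prod X Y)))))"
  have hom: "hom_sum (spectrum B) (unlabel (lgraph_prod X Y))
      = ?n ^ card (verts (unlabel (lgraph_prod X Y))) * F Y"
    if "two_labelled Y" for Y :: "(nat,nat) lgraph"
    unfolding F_def by (rule hom_sum_spectrum[OF fin_digraph_prod[OF X that] B])
  have par: "?N * F (parallel_graph k) = (\<Sum>a\<in>UNIV. \<Sum>b\<in>UNIV. W a b * spectrum B (b - a) ^ k)" for k
    using hom[OF two_labelled_parallel_graph, of k]
    by (simp only: hom_sum_prod[OF X two_labelled_parallel_graph] pinned_hom_sum_parallel_graph
        card_verts_prod_parallel_graph[OF X labs] W_def)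
  have "?N * F K1 = ?n * (?n ^ card (verts (unlabel (lgraph_prod X K1))) * F K1)"
    by (simp add: card_verts_prod_K1[OF X labs, symmetric] del: unlabel_prod_simps)
  also have "\<dots> = ?n * (\<Sum>a\<in>UNIV. \<Sum>b\<in>UNIV. W a b * (if a = b then 1 else 0))"
    by (simp only: hom[OF two_labelled_K1, symmetric] hom_sum_prod[OF X two_labelled_K1]
        pinned_hom_sum_K1 W_def)
  finally have K1: "?N * F K1 = ?n * (\<Sum>a\<in>UNIV. \<Sum>b\<in>UNIV. W a b * (if a = b then 1 else 0))" .
  have "?N * (\<Sum>k = 0..degree q. coeff q k * F (parallel_graph k))
      = (\<Sum>k = 0..degree q. \<Sum>a\<in>UNIV. \<Sum>b\<in>UNIV. W a b * (coeff q k * spectrum B (b - a) ^ k))"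
    by (simp add: sum_distrib_left mult.left_commute[of ?N] par) (simp add: mult_ac)
  also have "\<dots> = (\<Sum>a\<in>UNIV. \<Sum>k = 0..degree q. \<Sum>b\<in>UNIV. W a b * (coeff q k * spectrum B (b - a) ^ k))"
    by (rule sum.swap)
  also have "\<dots> = (\<Sum>a\<in>UNIV. \<Sum>b\<in>UNIV. \<Sum>k = 0..degree q. W a b * (coeff q k * spectrum B (b - a) ^ k))"
    by (intro sum.cong refl sum.swap)
  also have "\<dots> = (\<Sum>a\<in>UNIV. \<Sum>b\<in>UNIV. W a b * poly q (spectrum B (b - a)))"
    by (simp add: poly_altdef sum_distrib_left atMost_atLeast0)
  also have "\<dots> = (\<Sum>a\<in>UNIV. \<Sum>b\<in>UNIV. c * (W a b * (if a = b then 1 else 0)))"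
    by (intro sum.cong refl) (auto simp: q)
  finally have "?n / c * (?N * (\<Sum>k = 0..degree q. coeff q k * F (parallel_graph k))) = ?N * F K1"
    using \<open>c \<noteq> 0\<close> by (simp add: K1 sum_distrib_left)
  then have "?N * (?n / c * (\<Sum>k = 0..degree q. coeff q k * F (parallel_graph k))) = ?N * F K1"
    by (simp only: mult.left_commute[of ?N])
  then have "?n / c * (\<Sum>k = 0..degree q. coeff q k * F (parallel_graph k)) = F K1"
    by (rule mult_left_cancel[THEN iffD1, rotated]) simp
  then show "qeval (\<lambda>G. real (card (B_flows B G))) (qprod (qof X) ?Z)
      = qeval (\<lambda>G. real (card (B_flows B G))) (qprod (qof X) (qof K1))"
    by (simp add: qeval_qprod_simps F_def del: unlabel_prod_simps)
qed

text \<open>The pinned weights of the paths are the powers of the adjacency matrix.  Since \<open>q(A)\<close> is the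
  constant matrix with entries \<open>c / n\<close>, solving for its constant term \<open>q\<^sub>0 I\<close> expresses the
  identity matrix, which is the pinned weight of \<open>K1\<close>, by the all-ones matrix and the positive
  powers.\<close>

theorem contractor_B_tensions:
  fixes B :: "'a::{ab_group_add,finite} set"
  assumes q: "\<And>d. real CARD('a) * poly_conv q B d = c" and "coeff q 0 \<noteq> 0"
  shows "contractor
      (\<lambda>G :: (('v + nat) set, 'e + nat) pre_digraph.
          real CARD('a) ^ num_components G * real (card (B_tensions B G)))
      (qscale (1 / coeff q 0)
        (qscale (c / real CARD('a)) (qof K2_bar)
          - (\<Sum>k = 1..degree q. qscale (coeff q k) (qof (path_graph k)))))"
    (is "contractor _ ?Z")
  unfolding contractor_def
proof (intro conjI allI impI ballI)
  fix Y assume "Y \<in> Poly_Mapping.keys ?Z"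
  then have "Y \<in> {K2_bar} \<union> path_graph ` {1..degree q}"
  proof (rule subsetD[rotated])
    show "Poly_Mapping.keys ?Z \<subseteq> {K2_bar} \<union> path_graph ` {1..degree q}"
      by (intro order_trans[OF keys_qscale] order_trans[OF Poly_Mapping.keys_diff]
          Un_mono keys_sum_qscale_qof) simp
  qed
  then show "two_labelled Y"
    using two_labelled_K2_bar two_labelled_path_graph by auto
next
  fix X :: "('v,'e) lgraph"
  assume "two_labelled X \<and> lab1 X \<noteq> lab2 X \<and>
    (lab1 X, lab2 X) \<notin> arcs_ends (unlabel X) \<and> (lab2 X, lab1 X) \<notin> arcs_ends (unlabel X)"
  then have X: "two_labelled X" by auto
  let ?n = "real CARD('a)"
  let ?h = "\<lambda>G :: (('v + nat) set, 'e + nat) pre_digraph.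
    ?n ^ num_components G * real (card (B_tensions B G))"
  define W :: "'a \<Rightarrow> 'a \<Rightarrow> real" where "W = pinned_hom_sum (indicator B) X"
  define N :: "nat \<Rightarrow> 'a \<Rightarrow> real" where "N = conv_power (indicator B)"
  have hom: "?h (unlabel (lgraph_prod X Y)) = (\<Sum>a\<in>UNIV. \<Sum>b\<in>UNIV. W a b * pinned_hom_sum (indicator B) Y a b)"
    if "two_labelled Y" for Y :: "(nat,nat) lgraph"
    unfolding hom_sum_indicator[OF fin_digraph_prod[OF X that], symmetric] W_def
    by (rule hom_sum_prod[OF X that])
  have solve: "c / ?n - (\<Sum>k = 1..degree q. coeff q k * N k d) = (if d = 0 then coeff q 0 else 0)" for d
  proof -
    have "c / ?n = poly_conv q B d"
      using q[of d] by (simp add: field_simps)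
    also have "\<dots> = coeff q 0 * N 0 d + (\<Sum>k = 1..degree q. coeff q k * N k d)"
      by (simp add: poly_conv_def N_def atMost_atLeast0 sum.atLeast_Suc_atMost)
    finally show ?thesis
      by (simp add: N_def)
  qed
  have "(\<Sum>k = 1..degree q. coeff q k * (\<Sum>a\<in>UNIV. \<Sum>b\<in>UNIV. W a b * N k (b - a)))
      = (\<Sum>k = 1..degree q. \<Sum>a\<in>UNIV. \<Sum>b\<in>UNIV. W a b * (coeff q k * N k (b - a)))"
    by (simp add: sum_distrib_left mult_ac)
  also have "\<dots> = (\<Sum>a\<in>UNIV. \<Sum>k = 1..degree q. \<Sum>b\<in>UNIV. W a b * (coeff q k * N k (b - a)))"
    by (rule sum.swap)
  also have "\<dots> = (\<Sum>a\<in>UNIV. \<Sum>b\<in>UNIV. \<Sum>k = 1..degree q. W a b * (coeff q k * N k (b - a)))"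
    by (intro sum.cong refl sum.swap)
  finally have "c / ?n * (\<Sum>a\<in>UNIV. \<Sum>b\<in>UNIV. W a b)
        - (\<Sum>k = 1..degree q. coeff q k * (\<Sum>a\<in>UNIV. \<Sum>b\<in>UNIV. W a b * N k (b - a)))
      = (\<Sum>a\<in>UNIV. \<Sum>b\<in>UNIV. W a b * (c / ?n - (\<Sum>k = 1..degree q. coeff q k * N k (b - a))))"
    by (simp only: right_diff_distrib sum_subtractf sum_distrib_left mult.commute[of "c / ?n"] sum_distrib_right)
  also have "\<dots> = (\<Sum>a\<in>UNIV. \<Sum>b\<in>UNIV. coeff q 0 * (W a b * (if a = b then 1 else 0)))"
    unfolding solve by (intro sum.cong refl) auto
  finally have "1 / coeff q 0 * (c / ?n * (\<Sum>a\<in>UNIV. \<Sum>b\<in>UNIV. W a b)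
        - (\<Sum>k = 1..degree q. coeff q k * (\<Sum>a\<in>UNIV. \<Sum>b\<in>UNIV. W a b * N k (b - a))))
      = (\<Sum>a\<in>UNIV. \<Sum>b\<in>UNIV. W a b * (if a = b then 1 else 0))"
    using \<open>coeff q 0 \<noteq> 0\<close> by (simp only: sum_distrib_left[symmetric]) simp
  then show "qeval ?h (qprod (qof X) ?Z) = qeval ?h (qprod (qof X) (qof K1))"
    by (simp only: qeval_qprod_simps hom two_labelled_K1 two_labelled_K2_bar two_labelled_path_graph
        pinned_hom_sum_K1 pinned_hom_sum_K2_bar pinned_hom_sum_path_graph N_def mult_1 mult_1_right)
qed

theorem theorem14:
  fixes B :: "'a::{ab_group_add,finite} set"
    and mul :: "'a \<Rightarrow> 'a \<Rightarrow> 'a" and u :: 'a and \<xi> :: "'a \<Rightarrow> complex"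
    and n l :: nat and p q :: "real poly"
  assumes "ring_structure mul u"
    and "generating_character mul \<xi>"
    and "n = CARD('a)"
    and "B \<subseteq> UNIV - {0}"
    and "B = uminus ` B"
    and "Digraph_Component.connected (with_proj (cayley B))"
    and "minimum_polynomial (cayley_matrix B) p"
    and "l = degree p"
    and "q = p div [:- real (card B), 1:]"
  shows
    "{c::complex. eigenvalue_of (cayley_matrix B) c} = range (fourier mul \<xi> (indicator B))
     \<and> l = card {c::complex. eigenvalue_of (cayley_matrix B) c}
     \<and> contractor
         (\<lambda>G :: (('v + nat) set, 'e + nat) pre_digraph. real (card (B_flows B G)))
         (qscale (real n / poly q (real (card B)))
           (\<Sum>k = 0..l - 1. qscale (coeff q k) (qof (parallel_graph k))))
     \<and> (coeff q 0 \<noteq> 0 \<longrightarrow>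
        contractor
          (\<lambda>G :: (('v + nat) set, 'e + nat) pre_digraph.
              real n ^ num_components G * real (card (B_tensions B G)))
          (qscale (1 / coeff q 0)
            (qscale (poly q (real (card B)) / real n) (qof K2_bar)
              - (\<Sum>k = 1..l - 1. qscale (coeff q k) (qof (path_graph k))))))"
proof -
  define e where "e = (\<lambda>x y. \<xi> (mul x y))"
  interpret nondegenerate_bicharacter e
    unfolding e_def by (rule bicharacter_generating_character) fact+
  have fourier: "fourier mul \<xi> \<alpha> = dft \<alpha>" for \<alpha>
    by (intro ext) (simp only: fourier_def dft_def, simp only: e_def)
  note B = \<open>B = uminus ` B\<close>
  note quotient = quotient_polynomial[OF B assms(7,6,9)]
  have deg: "l - 1 = degree q"
    using quotient(3) assms(8) by simp
  have eig: "{c::complex. eigenvalue_of (cayley_matrix B) c} = range (fourier mul \<xi> (indicator B))"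
    unfolding fourier by (rule eigenvalues_cayley)
  have "range (fourier mul \<xi> (indicator B)) = complex_of_real ` range (spectrum B)"
    by (simp add: fourier dft_indicator[OF B] image_image)
  then have "card {c::complex. eigenvalue_of (cayley_matrix B) c} = card (range (spectrum B))"
    unfolding eig by (simp only: card_image[OF inj_onI[OF of_real_eq_iff[THEN iffD1]]])
  then have card: "l = card {c::complex. eigenvalue_of (cayley_matrix B) c}"
    using degree_minimum_polynomial[OF B assms(7)] assms(8) by simp
  have "real n * poly_conv q B d = poly q (real (card B))" for d
    unfolding assms(3) by (rule poly_conv_quotient[OF B assms(7,6,9)])
  then show ?thesis
    using eig card contractor_B_flows[OF B quotient(1,2)] contractor_B_tensions[of q B]
    unfolding deg assms(3) by blast
qed

end
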